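(* Let $(A,\mathfrak m)$ be a Cohen-Macaulay local ring of dimension two and let $N$ be a parameter module in a free module $F=A^r$ of rank $r>0$, namely, $\ell_A(F/N)<\infty$ and $\mu_A(N)=r+1$. Assume that $N\subseteq \mathfrak m F$ and put $M=N:_F\mathfrak m$, the socle module of $N$. Then the following three conditions are equivalent. (1) $M^2\neq NM$. (2) $N$ is an integrally closed module in $F$. (3) $A$ is a regular local ring, $r=1$, and $N$ is an integrally closed ideal in $A$.
   Context: $\ell_A(-)$ denotes length and $\mu_A(-)$ the minimal number of generators of an $A$-module. $N:_F\mathfrak m=\{f\in F : \mathfrak m f\subseteq N\}$. Let $S=\operatorname{Sym}_A(F)$ be the symmetric algebra of $F$ (a polynomial ring in $r$ variables over $A$), with $F$ identified with the degree-one component $S_1$. For submodules $N,M$ of $F$, the product $NM$ is the $A$-submodule of $S_2$ generated by all products $xy$ with $x\in N$, $y\in M$, and $M^2=MM$. For a submodule $N\subseteq F$, the Rees algebra $\mathcal R(N)$ is the image of the natural homomorphism $\operatorname{Sym}_A(N)\to S$, i.e. the $A$-subalgebra of $S$ generated by $N\subseteq S_1$. An element $f\in F=S_1$ is integral over $N$ if it is integral over the subring $\mathcal R(N)$ of $S$; the set $\overline N$ of all such $f\in F$ is the integral closure of $N$ in $F$, and $N$ is integrally closed in $F$ if $\overline N=N$. All local rings are Noetherian. *)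

theory Defs
  imports
    "HOL-Analysis.Finite_Cartesian_Product"
    "HOL-Library.Extended_Nat"
    "HOL-Library.Poly_Mapping"
    "HOL-Computational_Algebra.Polynomial"
begin

text \<open>
  The ring \<open>A\<close> is a type of class \<^class>\<open>comm_ring_1\<close>. Modules over it are given by a scalar
  multiplication \<open>act\<close> as in \<^locale>\<open>module\<close>; submodules are \<^const>\<open>module.subspace\<close> and generated
  submodules are \<^const>\<open>module.span\<close>. With \<open>act = (*)\<close> these are ideals and generated ideals.
  The free module \<open>F\<close> of rank \<open>r = CARD('n)\<close> is \<open>'a ^ 'n\<close> with the action \<open>(*s)\<close>.
\<close>

lemma module_ring: "module ((*) :: 'a::comm_ring_1 \<Rightarrow> 'a \<Rightarrow> 'a)"
  by unfold_locales (simp_all add: distrib_left distrib_right mult.assoc)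

lemma module_vec: "module ((*s) :: 'a::comm_ring_1 \<Rightarrow> 'a ^ 'n \<Rightarrow> 'a ^ 'n)"
  by unfold_locales (auto simp: vec_eq_iff algebra_simps)

section \<open>Length and number of generators\<close>

text \<open>
  The length of \<open>L/N\<close>: submodules of the quotient are submodules of \<open>L\<close> containing \<open>N\<close>, so this is
  the supremum of the lengths of strict chains of such submodules.
\<close>

definition quotient_length ::
    "('a::comm_ring_1 \<Rightarrow> 'b::ab_group_add \<Rightarrow> 'b) \<Rightarrow> 'b set \<Rightarrow> 'b set \<Rightarrow> enat" where
  "quotient_length act L N =
     (SUP k \<in> {k. \<exists>U. (\<forall>i\<le>k. module.subspace act (U i) \<and> N \<subseteq> U i \<and> U i \<subseteq> L) \<and>
                      (\<forall>i<k. U i \<subset> U (Suc i))}. enat k)"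

text \<open>The value is \<open>\<infinity>\<close> if the submodule \<open>N\<close> is not finitely generated.\<close>

definition min_gens ::
    "('a::comm_ring_1 \<Rightarrow> 'b::ab_group_add \<Rightarrow> 'b) \<Rightarrow> 'b set \<Rightarrow> enat" where
  "min_gens act N = (INF G \<in> {G. finite G \<and> module.span act G = N}. enat (card G))"


section \<open>Local rings\<close>

definition prime_ideal_of_ring :: "'a::comm_ring_1 set \<Rightarrow> bool" where
  "prime_ideal_of_ring P \<longleftrightarrow>
     module.subspace (*) P \<and> P \<noteq> UNIV \<and> (\<forall>x y. x * y \<in> P \<longrightarrow> x \<in> P \<or> y \<in> P)"

definition maximal_ideal_of_ring :: "'a::comm_ring_1 set \<Rightarrow> bool" where
  "maximal_ideal_of_ring P \<longleftrightarrow>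
     module.subspace (*) P \<and> P \<noteq> UNIV \<and>
     (\<forall>J. module.subspace (*) J \<and> P \<subseteq> J \<longrightarrow> J = P \<or> J = UNIV)"

definition noetherian_local_ring :: "'a::comm_ring_1 set \<Rightarrow> bool" where
  "noetherian_local_ring m \<longleftrightarrow>
     (\<forall>I :: 'a set. module.subspace (*) I \<longrightarrow> (\<exists>G. finite G \<and> module.span (*) G = I)) \<and>
     {P. maximal_ideal_of_ring P} = {m}"

definition krull_dimension :: "'a::comm_ring_1 itself \<Rightarrow> enat" where
  "krull_dimension _ =
     (SUP k \<in> {k. \<exists>P :: nat \<Rightarrow> 'a set. (\<forall>i\<le>k. prime_ideal_of_ring (P i)) \<and>
                                       (\<forall>i<k. P i \<subset> P (Suc i))}. enat k)"

definition regular_sequence :: "'a::comm_ring_1 list \<Rightarrow> bool" where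
  "regular_sequence xs \<longleftrightarrow>
     module.span (*) (set xs) \<noteq> UNIV \<and>
     (\<forall>i<length xs. \<forall>y. xs ! i * y \<in> module.span (*) (set (take i xs)) \<longrightarrow>
                        y \<in> module.span (*) (set (take i xs)))"

definition ring_depth :: "'a::comm_ring_1 set \<Rightarrow> enat" where
  "ring_depth m = (SUP xs \<in> {xs. set xs \<subseteq> m \<and> regular_sequence xs}. enat (length xs))"

definition cohen_macaulay_local_ring :: "'a::comm_ring_1 set \<Rightarrow> bool" where
  "cohen_macaulay_local_ring m \<longleftrightarrow>
     noetherian_local_ring m \<and> ring_depth m = krull_dimension TYPE('a)"

definition regular_local_ring :: "'a::comm_ring_1 set \<Rightarrow> bool" where
  "regular_local_ring m \<longleftrightarrow>
     noetherian_local_ring m \<and> min_gens (*) m = krull_dimension TYPE('a)"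


section \<open>Submodules of a free module\<close>

definition parameter_module :: "('a::comm_ring_1 ^ 'n) set \<Rightarrow> bool" where
  "parameter_module N \<longleftrightarrow>
     module.subspace (*s) N \<and>
     quotient_length (*s) UNIV N < \<infinity> \<and>
     min_gens (*s) N = enat (CARD('n) + 1)"

definition ideal_times_free :: "'a::comm_ring_1 set \<Rightarrow> ('a ^ 'n) set" where
  "ideal_times_free I = module.span (*s) {c *s f | c f. c \<in> I}"

definition module_colon :: "('a::comm_ring_1 ^ 'n) set \<Rightarrow> 'a set \<Rightarrow> ('a ^ 'n) set" where
  "module_colon N I = {f. \<forall>c\<in>I. c *s f \<in> N}"


section \<open>Symmetric algebra, products, integral closure\<close>

text \<open>
  \<open>Sym(F)\<close> is the polynomial ring over \<open>A\<close> in variables indexed by \<open>'n\<close>: exponent vectors are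
  \<open>'n \<Rightarrow>\<^sub>0 nat\<close>, and the convolution product of \<^theory>\<open>HOL-Library.Poly_Mapping\<close> is the
  multiplication of polynomials.
\<close>

type_synonym ('a, 'n) sym_alg = "('n \<Rightarrow>\<^sub>0 nat) \<Rightarrow>\<^sub>0 'a"

definition sym_const :: "'a::comm_ring_1 \<Rightarrow> ('a, 'n) sym_alg" where
  "sym_const c = Poly_Mapping.single 0 c"

text \<open>The identification of \<open>F\<close> with the degree-one component of \<open>Sym(F)\<close>.\<close>

definition sym_lin :: "'a::comm_ring_1 ^ 'n \<Rightarrow> ('a, 'n::finite) sym_alg" where
  "sym_lin f = (\<Sum>i\<in>UNIV. Poly_Mapping.single (Poly_Mapping.single i 1) (f $ i))"

definition sym_scale :: "'a::comm_ring_1 \<Rightarrow> ('a, 'n) sym_alg \<Rightarrow> ('a, 'n) sym_alg" where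
  "sym_scale c p = sym_const c * p"

lemma module_sym: "module (sym_scale :: 'a::comm_ring_1 \<Rightarrow> ('a, 'n) sym_alg \<Rightarrow> ('a, 'n) sym_alg)"
  by unfold_locales
    (auto simp: sym_scale_def sym_const_def algebra_simps single_add mult_single single_one
      simp flip: mult.assoc)

definition submodule_prod ::
    "('a::comm_ring_1 ^ 'n) set \<Rightarrow> ('a ^ 'n) set \<Rightarrow> ('a, 'n::finite) sym_alg set" where
  "submodule_prod N M = module.span sym_scale {sym_lin x * sym_lin y | x y. x \<in> N \<and> y \<in> M}"

text \<open>Closure under negation follows from the constants being included.\<close>

inductive_set rees_algebra :: "('a::comm_ring_1 ^ 'n) set \<Rightarrow> ('a, 'n::finite) sym_alg set"
  for N :: "('a ^ 'n) set" where
  const: "sym_const c \<in> rees_algebra N"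
| lin: "x \<in> N \<Longrightarrow> sym_lin x \<in> rees_algebra N"
| add: "p \<in> rees_algebra N \<Longrightarrow> q \<in> rees_algebra N \<Longrightarrow> p + q \<in> rees_algebra N"
| mult: "p \<in> rees_algebra N \<Longrightarrow> q \<in> rees_algebra N \<Longrightarrow> p * q \<in> rees_algebra N"

definition integral_over_subring :: "'s::comm_ring_1 set \<Rightarrow> 's \<Rightarrow> bool" where
  "integral_over_subring R s \<longleftrightarrow>
     (\<exists>p :: 's poly. lead_coeff p = 1 \<and> (\<forall>i. coeff p i \<in> R) \<and> poly p s = 0)"

definition module_integral_closure ::
    "('a::comm_ring_1 ^ 'n::finite) set \<Rightarrow> ('a ^ 'n) set" where
  "module_integral_closure N = {f. integral_over_subring (rees_algebra N) (sym_lin f)}"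

definition integrally_closed_module :: "('a::comm_ring_1 ^ 'n::finite) set \<Rightarrow> bool" where
  "integrally_closed_module N \<longleftrightarrow> module_integral_closure N = N"


section \<open>Integrally closed ideals\<close>

primrec ideal_power :: "'a::comm_ring_1 set \<Rightarrow> nat \<Rightarrow> 'a set" where
  "ideal_power I 0 = UNIV"
| "ideal_power I (Suc k) = module.span (*) {x * y | x y. x \<in> I \<and> y \<in> ideal_power I k}"

definition ideal_integral_closure :: "'a::comm_ring_1 set \<Rightarrow> 'a set" where
  "ideal_integral_closure I =
     {x. \<exists>k>0. \<exists>a. (\<forall>i\<in>{1..k}. a i \<in> ideal_power I i) \<and>
                   x ^ k + (\<Sum>i=1..k. a i * x ^ (k - i)) = 0}"

definition integrally_closed_ideal :: "'a::comm_ring_1 set \<Rightarrow> bool" where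
  "integrally_closed_ideal I \<longleftrightarrow> module.subspace (*) I \<and> ideal_integral_closure I = I"

end

theory Submission
  imports Defs "HOL-Analysis.Determinants"
begin

text \<open>
  Let \<open>r\<close> be the rank of \<open>F\<close>, let \<open>n\<^sub>1, \<dots>, n\<^sub>r\<^sub>+\<^sub>1\<close> generate \<open>N\<close>, and let \<open>\<Delta>\<^sub>i\<close> be the signed maximal minors of
  the matrix with columns \<open>n\<^sub>i\<close>. Some power of every element of \<open>m\<close> maps \<open>F\<close> into \<open>N\<close>, and \<open>A\<close> has
  depth two. This makes the Buchsbaum-Rim complex and its quadratic companion exact in the middle:
  every relation \<open>\<Sum> k\<^sub>i n\<^sub>i = 0\<close> over \<open>A\<close> is a multiple of \<open>\<Delta>\<close>
  (\<open>relations_are_multiples_of_signed_minors\<close>), and every relation \<open>\<Sum> n\<^sub>i h\<^sub>i = 0\<close> in \<open>S\<^sub>2\<close>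
  with \<open>h\<^sub>i \<in> F\<close> has all \<open>h\<^sub>i \<in> N\<close> (\<open>quadratic_relation_coefficients\<close>). Both are proved by
  contracting with explicit sections over two powers \<open>a\<close>, \<open>b\<close> of a regular sequence and dividing
  afterwards.

  The theorem follows from a dichotomy: either \<open>m M \<subseteq> m N\<close> (called \<open>socle_tight\<close>) or not.

  If \<open>m M \<subseteq> m N\<close>, then \<open>M \<subseteq> m F\<close> by Nakayama's lemma. For \<open>f, h \<in> M\<close> one can therefore write
  \<open>f h = \<Sum> n\<^sub>i \<alpha>\<^sub>i\<close> with \<open>\<alpha>\<^sub>i \<in> F\<close>. If \<open>x \<in> m\<close> then \<open>x f = \<Sum> p\<^sub>i n\<^sub>i\<close> with \<open>p\<^sub>i \<in> m\<close>, so
  \<open>\<Sum> n\<^sub>i (x \<alpha>\<^sub>i - p\<^sub>i h) = 0\<close>. All \<open>x \<alpha>\<^sub>i - p\<^sub>i h\<close> lie in \<open>N\<close>, and so do the \<open>p\<^sub>i h\<close>; thus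
  \<open>\<alpha>\<^sub>i \<in> M\<close> and \<open>M\<^sup>2 = N M\<close> (\<open>socle_square_if_socle_tight\<close>). This is the argument of Corso and
  Polini for parameter ideals, with the Koszul relations replaced by the quadratic ones above.

  If \<open>m M \<subseteq> m N\<close> fails, there are \<open>f \<in> M\<close> and \<open>x \<in> m\<close> with \<open>x f = \<Sum> w\<^sub>i n\<^sub>i\<close> and some \<open>w\<^sub>i\<close> a
  unit. For \<open>z \<in> m\<close> write \<open>z f = \<Sum> w'\<^sub>i n\<^sub>i\<close>; then \<open>x w' - z w\<close> is a multiple of \<open>\<Delta>\<close>, and its
  \<open>i\<close>-th entry shows \<open>z \<in> (x, \<Delta>\<^sub>i)\<close>. So \<open>m = (x, \<Delta>\<^sub>i)\<close>. When \<open>r \<ge> 2\<close> the minor \<open>\<Delta>\<^sub>i\<close> lies in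
  \<open>m\<^sup>2\<close>, which leaves \<open>m = (x)\<close> and contradicts depth two. When \<open>r = 1\<close> the minor is, up to a unit, a
  generator \<open>t\<close> of the ideal \<open>N\<close>; hence \<open>A\<close> is regular and \<open>N = (x\<^sup>e, t)\<close> is integrally closed,
  since \<open>A/(t)\<close> behaves like a discrete valuation ring with uniformizer \<open>x\<close>
  (\<open>regular_and_closed_if_not_socle_tight\<close>). So condition (3) holds.

  Two implications remain. If \<open>M\<^sup>2 = N M\<close>, then every \<open>f \<in> M\<close> maps the finitely generated faithful
  module \<open>M\<close> into \<open>N M\<close> and is therefore integral over \<open>N\<close>, while \<open>M \<noteq> N\<close>; so \<open>N\<close> is not integrally
  closed (\<open>not_integrally_closed_if_square_eq\<close>). If \<open>r = 1\<close>, the homogeneous component of degree \<open>d\<close>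
  of an integral equation of degree \<open>d\<close> over the Rees algebra is one over the ideal \<open>N\<close>
  (\<open>integrally_closed_if_rank_one\<close>), so (3) implies (2).
\<close>

section \<open>Regular pairs\<close>

text \<open>
  A weakly regular sequence of length two: \<open>(a, b)\<close> need not be a proper ideal. Allowing this makes the
  notion stable under all powers, including the exponent \<open>0\<close>.
\<close>

definition regular_pair :: "'a::comm_ring_1 \<Rightarrow> 'a \<Rightarrow> bool" where
  "regular_pair a b \<longleftrightarrow> (\<forall>y. a * y = 0 \<longrightarrow> y = 0) \<and> (\<forall>y. a dvd b * y \<longrightarrow> a dvd y)"

lemma regular_pairD1:
  assumes "regular_pair a b" "a * y = 0" shows "y = 0"
  by (rule assms(1)[unfolded regular_pair_def, THEN conjunct1, THEN spec, THEN mp, OF assms(2)])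

lemma regular_pairD2:
  assumes "regular_pair a b" "a dvd b * y" shows "a dvd y"
  by (rule assms(1)[unfolded regular_pair_def, THEN conjunct2, THEN spec, THEN mp, OF assms(2)])

lemma regular_pairI:
  "(\<And>y. a * y = 0 \<Longrightarrow> y = 0) \<Longrightarrow> (\<And>y. a dvd b * y \<Longrightarrow> a dvd y) \<Longrightarrow> regular_pair a b"
  unfolding regular_pair_def by (intro conjI allI impI)

lemma regular_pair_cancel:
  assumes "regular_pair a b" "a * x = a * y" shows "x = y"
proof -
  have "a * (x - y) = 0" unfolding right_diff_distrib assms(2) by (rule diff_self)
  from regular_pairD1[OF assms(1) this] show ?thesis by simp
qed

lemma regular_pair_power_right:
  assumes "regular_pair a b" shows "regular_pair a (b ^ l)"
proof (rule regular_pairI)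
  fix y
  show "a dvd y" if "a dvd b ^ l * y"
    using that
  proof (induction l)
    case (Suc l)
    from Suc.prems have "a dvd b * (b ^ l * y)" by (simp only: power_Suc mult.assoc)
    then show ?case by (rule Suc.IH[OF regular_pairD2[OF assms]])
  qed simp
qed (rule regular_pairD1[OF assms])

lemma regular_pair_power_left:
  assumes "regular_pair a b" shows "regular_pair (a ^ k) b"
proof (rule regular_pairI)
  fix y
  show "y = 0" if "a ^ k * y = 0"
    using that
  proof (induction k)
    case (Suc k)
    from Suc.prems have "a * (a ^ k * y) = 0" by (simp only: power_Suc mult.assoc)
    then show ?case by (rule Suc.IH[OF regular_pairD1[OF assms]])
  qed simp
next
  fix y
  show "a ^ k dvd y" if "a ^ k dvd b * y"
    using that
  proof (induction k arbitrary: y)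
    case (Suc k)
    from Suc.prems obtain w where w: "b * y = a ^ Suc k * w" by (elim dvdE)
    have "b * y = a * (a ^ k * w)" by (simp only: w power_Suc mult.assoc)
    then have "a dvd b * y" by (rule dvdI)
    then obtain z where z: "y = a * z" using regular_pairD2[OF assms] by (blast elim: dvdE)
    have "a * (b * z) = a * (a ^ k * w)"
      using w by (simp only: z power_Suc mult_ac)
    from regular_pair_cancel[OF assms this] have "a ^ k dvd b * z" by simp
    from Suc.IH[OF this] show ?case by (simp add: z mult_dvd_mono)
  qed simp
qed

lemma regular_pair_power: "regular_pair a b \<Longrightarrow> regular_pair (a ^ k) (b ^ l)"
  by (simp add: regular_pair_power_left regular_pair_power_right)

section \<open>Maximal minors and the relations between the generators\<close>

lemma sum_UNIV_option:
  fixes f :: "'n::finite option \<Rightarrow> 'b::comm_monoid_add"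
  shows "(\<Sum>i\<in>UNIV. f i) = f None + (\<Sum>p\<in>UNIV. f (Some p))"
  by (simp add: UNIV_option_conv sum.reindex)

lemma prod_UNIV_option:
  fixes f :: "'n::finite option \<Rightarrow> 'b::comm_monoid_mult"
  shows "(\<Prod>i\<in>UNIV. f i) = f None * (\<Prod>p\<in>UNIV. f (Some p))"
  by (simp add: UNIV_option_conv prod.reindex)

text \<open>
  The index type \<open>'n option\<close> carries no order, so the library's results on triangular matrices do not
  apply; here every permutation other than the identity meets a zero entry.
\<close>

lemma det_block_triangular_option:
  fixes X :: "'a::comm_ring_1 ^ 'n::finite option ^ 'n option"
  assumes diag: "\<And>p q. p \<noteq> q \<Longrightarrow> X $ Some p $ Some q = 0"
    and border: "\<And>q. X $ None $ Some q = 0"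
  shows "det X = X $ None $ None * (\<Prod>p\<in>UNIV. X $ Some p $ Some p)"
proof -
  have zero: "(\<Prod>i\<in>UNIV. X $ i $ \<sigma> i) = 0" if "\<sigma> permutes UNIV" "\<sigma> \<noteq> id" for \<sigma>
  proof -
    have "\<exists>i. X $ i $ \<sigma> i = 0"
    proof (rule ccontr)
      assume "\<nexists>i. X $ i $ \<sigma> i = 0"
      then have nz: "X $ i $ \<sigma> i \<noteq> 0" for i by simp
      have N: "\<sigma> None = None"
        using nz[of None] border by (cases "\<sigma> None") auto
      have "\<sigma> (Some p) = Some p" for p
      proof -
        have "\<sigma> (Some p) \<noteq> None"
          using N injD[OF permutes_inj[OF that(1)], of "Some p" None] by auto
        then obtain q where q: "\<sigma> (Some p) = Some q" by blast
        then show ?thesis using nz[of "Some p"] diag[of p q] by (cases "p = q") auto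
      qed
      with N have "\<sigma> i = i" for i by (cases i) auto
      with that(2) show False by (auto simp: fun_eq_iff)
    qed
    then show ?thesis by (intro prod_zero) auto
  qed
  have "det X = (\<Sum>\<sigma>\<in>{id}. of_int (sign \<sigma>) * (\<Prod>i\<in>UNIV. X $ i $ \<sigma> i))"
    unfolding det_def
    by (rule sum.mono_neutral_right) (auto simp: zero permutes_id)
  then show ?thesis by (simp add: prod_UNIV_option)
qed

text \<open>
  The Schur complement formula for the scalar block \<open>a\<close>, multiplied by \<open>a\<close> so that no inverse of \<open>a\<close>
  occurs.
\<close>

lemma det_bordered_scalar:
  fixes X :: "'a::comm_ring_1 ^ 'n::finite option ^ 'n option"
  assumes diag: "\<And>p q. X $ Some p $ Some q = (if p = q then a else 0)"
  shows "a * det X = a ^ CARD('n) *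
    (a * X $ None $ None - (\<Sum>p\<in>UNIV. X $ None $ Some p * X $ Some p $ None))"
proof -
  define L :: "'a ^ 'n option ^ 'n option" where
    "L = (\<chi> r c. case r of Some p \<Rightarrow> (if c = Some p then 1 else 0)
            | None \<Rightarrow> (case c of None \<Rightarrow> a | Some q \<Rightarrow> - (X $ None $ Some q)))"
  have "det L = det (Finite_Cartesian_Product.transpose L)" by simp
  also have "\<dots> = L $ None $ None * (\<Prod>p\<in>UNIV. L $ Some p $ Some p)"
    by (subst det_block_triangular_option)
      (auto simp: Finite_Cartesian_Product.transpose_def L_def)
  finally have dL: "det L = a" by (simp add: L_def)
  have "L $ Some p $ k * z = (if k = Some p then z else 0)" for p k z
    by (simp add: L_def)
  then have S: "(L ** X) $ Some p $ c = X $ Some p $ c" for p c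
    by (simp add: matrix_matrix_mult_def)
  have N: "(L ** X) $ None $ c = a * X $ None $ c - (\<Sum>p\<in>UNIV. X $ None $ Some p * X $ Some p $ c)" for c
    by (simp add: matrix_matrix_mult_def L_def sum_UNIV_option sum_negf)
  have "(L ** X) $ None $ Some q = 0" for q
  proof -
    have "X $ None $ Some p * X $ Some p $ Some q = (if p = q then X $ None $ Some p * a else 0)" for p
      by (simp add: diag)
    then show ?thesis by (simp add: N mult.commute)
  qed
  then have "det (L ** X) = (L ** X) $ None $ None * (\<Prod>p\<in>UNIV. (L ** X) $ Some p $ Some p)"
    by (intro det_block_triangular_option) (auto simp: S diag)
  then show ?thesis by (simp add: det_mul dL S N diag mult.commute)
qed

lemma sum_indicator_mult:
  fixes f :: "'i::finite \<Rightarrow> 'a::comm_ring_1"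
  shows "(\<Sum>j\<in>UNIV. (if j = i then 1 else 0) * f j) = f i"
proof -
  have "(\<Sum>j\<in>UNIV. (if j = i then 1 else 0) * f j) = (\<Sum>j\<in>UNIV. if j = i then f j else 0)"
    by (intro sum.cong) auto
  then show ?thesis by simp
qed

text \<open>
  The \<open>i\<close>-th signed maximal minor of the matrix with columns \<open>g c\<close>: expanding the determinant along
  the unit vector in the row \<open>None\<close> removes column \<open>i\<close>.
\<close>

definition signed_minor :: "('n::finite option \<Rightarrow> 'a::comm_ring_1 ^ 'n) \<Rightarrow> 'n option \<Rightarrow> 'a" where
  "signed_minor g i =
     det (\<chi> r c. case r of Some p \<Rightarrow> g c $ p | None \<Rightarrow> if c = i then 1 else 0)"

text \<open>
  If \<open>a F\<close> is contained in the module spanned by the \<open>g i\<close>, then \<open>a\<close> times the identity of \<open>F\<close> factors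
  through the map \<open>A\<^sup>r\<^sup>+\<^sup>1 \<rightarrow> F\<close> given by \<open>g\<close>; \<open>\<psi>\<close> is the matrix of such a factorization.
\<close>

definition scaled_section ::
    "('n::finite option \<Rightarrow> 'a::comm_ring_1 ^ 'n) \<Rightarrow> 'a \<Rightarrow> ('n option \<Rightarrow> 'n \<Rightarrow> 'a) \<Rightarrow> bool" where
  "scaled_section g a \<psi> \<longleftrightarrow> (\<forall>p q. (\<Sum>i\<in>UNIV. \<psi> i p * g i $ q) = (if p = q then a else 0))"

definition augmented_det :: "('n::finite option \<Rightarrow> 'n \<Rightarrow> 'a::comm_ring_1) \<Rightarrow> ('n option \<Rightarrow> 'a) \<Rightarrow> 'a" where
  "augmented_det \<psi> k = det (\<chi> i c. case c of Some q \<Rightarrow> \<psi> i q | None \<Rightarrow> k i)"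

text \<open>
  The matrix defining \<open>signed_minor\<close> times the one defining \<open>augmented_det\<close> is a bordered scalar
  matrix. All facts about minors below come from this one product formula.
\<close>

lemma signed_minor_times_augmented_det:
  fixes g :: "'n::finite option \<Rightarrow> 'a::comm_ring_1 ^ 'n"
  assumes "scaled_section g a \<psi>"
  shows "a * (signed_minor g i * augmented_det \<psi> k) =
    a ^ CARD('n) * (a * k i - (\<Sum>q\<in>UNIV. \<psi> i q * (\<Sum>j\<in>UNIV. k j * g j $ q)))"
proof -
  let ?P = "(\<chi> r c. case r of Some p \<Rightarrow> g c $ p | None \<Rightarrow> if c = i then 1 else 0) :: 'a ^ 'n option ^ 'n option"
  let ?Q = "(\<chi> i c. case c of Some q \<Rightarrow> \<psi> i q | None \<Rightarrow> k i) :: 'a ^ 'n option ^ 'n option"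
  have "(?P ** ?Q) $ Some p $ Some q = (if p = q then a else 0)" for p q
  proof -
    have "(?P ** ?Q) $ Some p $ Some q = (\<Sum>i\<in>UNIV. \<psi> i q * g i $ p)"
      by (simp add: matrix_matrix_mult_def mult.commute)
    with assms show ?thesis by (auto simp: scaled_section_def)
  qed
  note bordered = det_bordered_scalar[OF this]
  have PN: "(?P ** ?Q) $ None $ c = ?Q $ i $ c" for c
    by (simp add: matrix_matrix_mult_def sum_indicator_mult)
  have SN: "(?P ** ?Q) $ Some q $ None = (\<Sum>j\<in>UNIV. k j * g j $ q)" for q
    by (simp add: matrix_matrix_mult_def mult.commute)
  have "det (?P ** ?Q) = signed_minor g i * augmented_det \<psi> k"
    by (simp only: det_mul signed_minor_def augmented_det_def)
  with bordered show ?thesis by (simp add: PN SN)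
qed

text \<open>
  Summing the product formula over the unit vectors turns the correction term into the trace of
  \<open>g \<circ> \<psi> = a\<close>, which is \<open>r a\<close>, and \<open>(r + 1) a - r a = a\<close>. In particular the ideal of maximal minors
  contains \<open>a\<^sup>r\<close>.
\<close>

lemma sum_signed_minor_augmented_det:
  fixes g :: "'n::finite option \<Rightarrow> 'a::comm_ring_1 ^ 'n"
  assumes sec: "scaled_section g a \<psi>" and reg: "regular_pair a b"
  shows "(\<Sum>i\<in>UNIV. signed_minor g i * augmented_det \<psi> (\<lambda>j. if j = i then 1 else 0)) = a ^ CARD('n)"
proof -
  let ?e = "\<lambda>i j :: 'n option. if j = i then (1 :: 'a) else 0"
  have inner: "(\<Sum>j\<in>UNIV. ?e i j * g j $ q) = g i $ q" for i q
    by (rule sum_indicator_mult)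
  have "(\<Sum>i\<in>UNIV. a * ?e i i - (\<Sum>q\<in>UNIV. \<psi> i q * (\<Sum>j\<in>UNIV. ?e i j * g j $ q)))
      = (\<Sum>i\<in>(UNIV::'n option set). a) - (\<Sum>i\<in>UNIV. \<Sum>q\<in>UNIV. \<psi> i q * g i $ q)"
    by (simp add: inner sum_subtractf)
  also have "(\<Sum>i\<in>UNIV. \<Sum>q\<in>UNIV. \<psi> i q * g i $ q) = (\<Sum>q\<in>(UNIV::'n set). a)"
    by (subst sum.swap) (use sec in \<open>simp add: scaled_section_def\<close>)
  also have "(\<Sum>i\<in>(UNIV::'n option set). a) - (\<Sum>q\<in>(UNIV::'n set). a) = a"
    by (simp add: sum_UNIV_option distrib_right)
  finally have s: "(\<Sum>i\<in>UNIV. a * ?e i i - (\<Sum>q\<in>UNIV. \<psi> i q * (\<Sum>j\<in>UNIV. ?e i j * g j $ q))) = a" .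
  have "a * (\<Sum>i\<in>UNIV. signed_minor g i * augmented_det \<psi> (?e i)) =
     (\<Sum>i\<in>UNIV. a ^ CARD('n) * (a * ?e i i - (\<Sum>q\<in>UNIV. \<psi> i q * (\<Sum>j\<in>UNIV. ?e i j * g j $ q))))"
    by (subst sum_distrib_left) (intro sum.cong refl signed_minor_times_augmented_det[OF sec])
  also have "\<dots> = a ^ CARD('n) * a"
    using s by (simp only: sum_distrib_left[symmetric])
  also have "\<dots> = a * a ^ CARD('n)" by (rule mult.commute)
  finally show ?thesis by (rule regular_pair_cancel[OF reg])
qed

text \<open>
  The ideal of maximal minors contains the nonzerodivisor \<open>a\<^sup>r\<close>.
\<close>

lemma eq_zero_if_signed_minors_annihilate:
  fixes g :: "'n::finite option \<Rightarrow> 'a::comm_ring_1 ^ 'n"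
  assumes sec: "scaled_section g a \<psi>" and reg: "regular_pair a b"
    and z: "\<And>i. signed_minor g i * x = 0"
  shows "x = 0"
proof -
  have "a ^ CARD('n) * x =
      (\<Sum>i\<in>UNIV. augmented_det \<psi> (\<lambda>j. if j = i then 1 else 0) * (signed_minor g i * x))"
    unfolding sum_signed_minor_augmented_det[OF sec reg, symmetric] sum_distrib_right
    by (intro sum.cong refl) (simp only: mult_ac)
  also have "\<dots> = 0" by (simp add: z)
  finally show ?thesis by (rule regular_pairD1[OF regular_pair_power_left[OF reg]])
qed

text \<open>
  The Laplace relation, here read off from the product formula: multiplied by any \<open>augmented_det\<close> the
  sum vanishes, and these determinants generate an ideal containing \<open>a\<^sup>r\<close>.
\<close>

lemma signed_minor_relation:
  fixes g :: "'n::finite option \<Rightarrow> 'a::comm_ring_1 ^ 'n"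
  assumes sec: "scaled_section g a \<psi>" and reg: "regular_pair a b"
  shows "(\<Sum>i\<in>UNIV. signed_minor g i * g i $ p) = 0"
proof (rule eq_zero_if_signed_minors_annihilate[OF sec reg])
  let ?S = "\<Sum>i\<in>UNIV. signed_minor g i * g i $ p"
  have S0: "?S * augmented_det \<psi> k = 0" for k
  proof (rule regular_pair_cancel[OF reg])
    let ?v = "\<lambda>q. \<Sum>j\<in>UNIV. k j * g j $ q"
    have "a * (?S * augmented_det \<psi> k) =
        (\<Sum>i\<in>UNIV. g i $ p * (a * (signed_minor g i * augmented_det \<psi> k)))"
      unfolding sum_distrib_right sum_distrib_left by (intro sum.cong refl) (simp only: mult_ac)
    also have "\<dots> = (\<Sum>i\<in>UNIV. g i $ p * (a ^ CARD('n) * (a * k i - (\<Sum>q\<in>UNIV. \<psi> i q * ?v q))))"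
      unfolding signed_minor_times_augmented_det[OF sec] ..
    also have "\<dots> = a ^ CARD('n) * (\<Sum>i\<in>UNIV. a * (k i * g i $ p) - (\<Sum>q\<in>UNIV. (\<psi> i q * g i $ p) * ?v q))"
    proof -
      have "g i $ p * (a ^ CARD('n) * (a * k i - (\<Sum>q\<in>UNIV. \<psi> i q * ?v q))) =
          a ^ CARD('n) * (a * (k i * g i $ p) - g i $ p * (\<Sum>q\<in>UNIV. \<psi> i q * ?v q))" for i
        by (simp only: right_diff_distrib mult_ac)
      moreover have "g i $ p * (\<Sum>q\<in>UNIV. \<psi> i q * ?v q) = (\<Sum>q\<in>UNIV. (\<psi> i q * g i $ p) * ?v q)" for i
        by (subst sum_distrib_left) (intro sum.cong refl, simp only: mult_ac)
      ultimately show ?thesis by (simp only: sum_distrib_left[symmetric])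
    qed
    also have "\<dots> = a ^ CARD('n) * (a * ?v p - (\<Sum>i\<in>UNIV. \<Sum>q\<in>UNIV. (\<psi> i q * g i $ p) * ?v q))"
      by (simp only: sum_subtractf sum_distrib_left[symmetric])
    also have "(\<Sum>i\<in>UNIV. \<Sum>q\<in>UNIV. (\<psi> i q * g i $ p) * ?v q) =
        (\<Sum>q\<in>UNIV. (\<Sum>i\<in>UNIV. \<psi> i q * g i $ p) * ?v q)"
      by (subst sum.swap) (simp only: sum_distrib_right)
    also have "\<dots> = a * ?v p"
      using sec by (simp add: scaled_section_def if_distrib[of "\<lambda>z. z * _"] cong: if_cong)
    finally show "a * (?S * augmented_det \<psi> k) = a * 0" by simp
  qed
  have "?S * a ^ CARD('n) = 0"
    unfolding sum_signed_minor_augmented_det[OF sec reg, symmetric]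
    by (subst sum_distrib_left) (use S0 in \<open>simp add: mult.left_commute\<close>)
  then have "a ^ CARD('n) * ?S = 0" by (simp only: mult.commute)
  from regular_pairD1[OF regular_pair_power_left[OF reg] this] have "?S = 0" .
  then show "signed_minor g i * ?S = 0" for i by simp
qed

text \<open>
  Exactness of the Buchsbaum-Rim complex at \<open>A\<^sup>r\<^sup>+\<^sup>1\<close>. The product formula makes \<open>a\<^sup>r k\<close> and
  \<open>b\<^sup>r\<^sup>+\<^sup>1 k\<close> multiples of the vector of minors; comparing the two factors and using that \<open>a, b\<close> is
  regular, the factor of the first one is divisible by \<open>a\<^sup>r\<close>.
\<close>

lemma relations_are_multiples_of_signed_minors:
  fixes g :: "'n::finite option \<Rightarrow> 'a::comm_ring_1 ^ 'n"
  assumes a: "scaled_section g a \<psi>" and b: "scaled_section g b \<psi>'"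
    and reg: "regular_pair a b"
    and rel: "\<And>p. (\<Sum>i\<in>UNIV. k i * g i $ p) = 0"
  obtains s where "\<And>i. k i = s * signed_minor g i"
proof -
  let ?r = "CARD('n)"
  have ka: "signed_minor g i * augmented_det \<psi> k = a ^ ?r * k i" for i
  proof (rule regular_pair_cancel[OF reg])
    show "a * (signed_minor g i * augmented_det \<psi> k) = a * (a ^ ?r * k i)"
      using signed_minor_times_augmented_det[OF a, of i k] by (simp add: rel mult.left_commute)
  qed
  have kb: "b * (signed_minor g i * augmented_det \<psi>' k) = b ^ Suc ?r * k i" for i
    using signed_minor_times_augmented_det[OF b, of i k] by (simp add: rel mult_ac)
  have "signed_minor g i * (b ^ Suc ?r * augmented_det \<psi> k - a ^ ?r * (b * augmented_det \<psi>' k)) = 0" for i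
  proof -
    have "b ^ Suc ?r * (signed_minor g i * augmented_det \<psi> k)
        = a ^ ?r * (b * (signed_minor g i * augmented_det \<psi>' k))"
      unfolding ka kb by (simp only: mult_ac)
    then show ?thesis by (simp add: right_diff_distrib mult_ac)
  qed
  then have "b ^ Suc ?r * augmented_det \<psi> k - a ^ ?r * (b * augmented_det \<psi>' k) = 0"
    by (rule eq_zero_if_signed_minors_annihilate[OF a reg])
  then have "a ^ ?r dvd b ^ Suc ?r * augmented_det \<psi> k" by simp
  from regular_pairD2[OF regular_pair_power[OF reg] this]
  obtain s where s: "augmented_det \<psi> k = a ^ ?r * s" by (elim dvdE)
  have "k i = s * signed_minor g i" for i
  proof (rule regular_pair_cancel[OF regular_pair_power_left[OF reg]])
    show "a ^ ?r * k i = a ^ ?r * (s * signed_minor g i)"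
      using ka[of i] by (simp add: s mult_ac)
  qed
  then show thesis by (rule that)
qed

section \<open>Quadratic relations between the generators\<close>

definition alternating :: "('i \<Rightarrow> 'i \<Rightarrow> 'a::comm_ring_1) \<Rightarrow> bool" where
  "alternating w \<longleftrightarrow> (\<forall>i. w i i = 0) \<and> (\<forall>i j. w i j = - w j i)"

lemma alternating_diag: "alternating w \<Longrightarrow> w i i = 0"
  by (simp add: alternating_def)

lemma alternating_swap: "alternating w \<Longrightarrow> w i j = - w j i"
  unfolding alternating_def by blast

lemma sum_alternating_eq_0:
  assumes "alternating w" "finite A"
  shows "(\<Sum>i\<in>A. \<Sum>j\<in>A. w i j) = 0"
  using assms(2)
proof induction
  case (insert x A)
  have "(\<Sum>i\<in>A. w i x) = - (\<Sum>j\<in>A. w x j)"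
    using alternating_swap[OF assms(1), of _ x] by (simp add: sum_negf)
  then show ?case
    using insert alternating_diag[OF assms(1), of x] by (simp add: sum.distrib)
qed simp

lemma alternating_congruence:
  assumes "alternating w"
  shows "alternating (\<lambda>i j. \<Sum>p\<in>(UNIV::'q::finite set). \<Sum>q\<in>UNIV. c i p * w p q * c j q)"
  unfolding alternating_def
proof (intro conjI allI)
  fix i
  have "alternating (\<lambda>p q. c i p * w p q * c i q)"
    unfolding alternating_def using alternating_diag[OF assms] alternating_swap[OF assms]
    by (metis (no_types, lifting) minus_mult_left minus_mult_right mult.assoc mult.commute mult_zero_right)
  then show "(\<Sum>p\<in>UNIV. \<Sum>q\<in>UNIV. c i p * w p q * c i q) = 0"
    by (rule sum_alternating_eq_0) simp
next
  fix i j
  have "c i p * w p q * c j q = - (c j q * w q p * c i p)" for p q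
    by (subst alternating_swap[OF assms]) (simp add: mult_ac)
  then have "(\<Sum>p\<in>UNIV. \<Sum>q\<in>UNIV. c i p * w p q * c j q)
      = - (\<Sum>p\<in>UNIV. \<Sum>q\<in>UNIV. c j q * w q p * c i p)"
    by (simp only: sum_negf)
  also have "\<dots> = - (\<Sum>p\<in>UNIV. \<Sum>q\<in>UNIV. c j p * w p q * c i q)"
    by (subst sum.swap) (rule refl)
  finally show "(\<Sum>p\<in>UNIV. \<Sum>q\<in>UNIV. c i p * w p q * c j q)
      = - (\<Sum>p\<in>UNIV. \<Sum>q\<in>UNIV. c j p * w p q * c i q)" .
qed

text \<open>
  Injectivity at the left end of the quadratic complex \<open>\<And>\<^sup>2 A\<^sup>r\<^sup>+\<^sup>1 \<rightarrow> A\<^sup>r\<^sup>+\<^sup>1 \<otimes> F \<rightarrow> S\<^sub>2\<close>. The rows of \<open>w\<close>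
  are multiples \<open>s\<^sub>i \<Delta>\<close> of the vector of minors. With \<open>\<Sum> c\<^sub>i \<Delta>\<^sub>i = a\<^sup>r\<close> the alternating form
  \<open>\<Sum> c\<^sub>i w\<^sub>i\<^sub>j c\<^sub>j = 0\<close> equals \<open>\<gamma> a\<^sup>r\<close> for \<open>\<gamma> = \<Sum> c\<^sub>i s\<^sub>i\<close>, so \<open>\<gamma> = 0\<close>; antisymmetry then
  gives \<open>a\<^sup>r s\<^sub>i = - \<gamma> \<Delta>\<^sub>i = 0\<close>. Using the vanishing diagonal avoids division by \<open>2\<close>.
\<close>

lemma alternating_syzygy_eq_0:
  fixes g :: "'n::finite option \<Rightarrow> 'a::comm_ring_1 ^ 'n"
  assumes a: "scaled_section g a \<psi>" and b: "scaled_section g b \<psi>'" and reg: "regular_pair a b"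
    and alt: "alternating w"
    and rel: "\<And>i p. (\<Sum>j\<in>UNIV. w i j * g j $ p) = 0"
  shows "w i j = 0"
proof -
  let ?r = "CARD('n)"
  let ?D = "signed_minor g"
  define c where "c i = augmented_det \<psi> (\<lambda>j. if j = i then 1 else 0)" for i
  have cD: "(\<Sum>i\<in>UNIV. ?D i * c i) = a ^ ?r"
    unfolding c_def by (rule sum_signed_minor_augmented_det[OF a reg])
  have "\<exists>s. \<forall>j. w i j = s * ?D j" for i
    using relations_are_multiples_of_signed_minors[OF a b reg rel, of i] by metis
  then obtain s where s: "w i j = s i * ?D j" for i j by metis
  let ?\<gamma> = "\<Sum>i\<in>UNIV. c i * s i"
  have "(\<Sum>p\<in>UNIV. \<Sum>q\<in>UNIV. c p * w p q * c q) = 0"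
    using alternating_diag[OF alternating_congruence[OF alt, of "\<lambda>_::unit. c"]] .
  also have "(\<Sum>p\<in>UNIV. \<Sum>q\<in>UNIV. c p * w p q * c q) = ?\<gamma> * a ^ ?r"
    unfolding cD[symmetric] sum_product by (intro sum.cong refl) (simp only: s mult_ac)
  finally have "a ^ ?r * ?\<gamma> = 0" by (simp only: mult.commute)
  from regular_pairD1[OF regular_pair_power_left[OF reg] this] have \<gamma>: "?\<gamma> = 0" .
  have "a ^ ?r * s i = (\<Sum>j\<in>UNIV. w i j * c j)" for i
    unfolding cD[symmetric] sum_distrib_right by (intro sum.cong refl) (simp only: s mult_ac)
  also have "\<dots> i = - (\<Sum>j\<in>UNIV. ?D i * (c j * s j))" for i
    unfolding sum_negf[symmetric]
    by (intro sum.cong refl) (subst alternating_swap[OF alt], simp add: s mult_ac)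
  also have "\<dots> i = 0" for i
    by (simp only: sum_distrib_left[symmetric] \<gamma> mult_zero_right minus_zero)
  finally have "a ^ ?r * s i = 0" for i .
  from regular_pairD1[OF regular_pair_power_left[OF reg] this] show ?thesis by (simp add: s)
qed

text \<open>
  If \<open>\<Sum> g\<^sub>i h\<^sub>i = 0\<close> in \<open>S\<^sub>2\<close>, then \<open>\<Sum> g\<^sub>i \<otimes> h\<^sub>i\<close> is an alternating tensor \<open>T\<close>. Lifting \<open>T\<close> along \<open>\<theta>\<close>
  to an alternating \<open>w\<^sub>0\<close> and subtracting its boundary from \<open>c\<^sup>2 h\<close> leaves an element of
  \<open>ker g \<otimes> F\<close>, that is \<open>\<Delta> \<otimes> s\<close>; and \<open>c (\<Delta> \<otimes> s)\<close> is the boundary of \<open>\<Delta> \<and> \<theta> s\<close>. So \<open>c\<^sup>3 h\<close> is a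
  combination of Koszul relations.
\<close>

lemma scaled_koszul_relation:
  fixes g h :: "'n::finite option \<Rightarrow> 'a::comm_ring_1 ^ 'n"
  assumes a: "scaled_section g a \<psi>" and b: "scaled_section g b \<psi>'" and reg: "regular_pair a b"
    and c: "scaled_section g c \<theta>"
    and alt: "alternating (\<lambda>p q. \<Sum>i\<in>UNIV. g i $ p * h i $ q)"
  obtains w where "alternating w" "\<And>i p. c ^ 3 * h i $ p = (\<Sum>j\<in>UNIV. w i j * g j $ p)"
proof -
  define T where "T p q = (\<Sum>i\<in>UNIV. g i $ p * h i $ q)" for p q
  let ?D = "signed_minor g"
  define w0 where "w0 i j = (\<Sum>p\<in>UNIV. \<Sum>q\<in>UNIV. \<theta> i p * T p q * \<theta> j q)" for i j
  have alt0: "alternating w0"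
    unfolding w0_def T_def by (rule alternating_congruence[OF alt])
  have sec: "(\<Sum>j\<in>UNIV. (\<Sum>q\<in>UNIV. x q * \<theta> j q) * g j $ l) = c * x l" for x l
  proof -
    have "(\<Sum>j\<in>UNIV. (\<Sum>q\<in>UNIV. x q * \<theta> j q) * g j $ l) = (\<Sum>j\<in>UNIV. \<Sum>q\<in>UNIV. x q * (\<theta> j q * g j $ l))"
      by (simp only: sum_distrib_right mult.assoc)
    also have "\<dots> = (\<Sum>q\<in>UNIV. x q * (\<Sum>j\<in>UNIV. \<theta> j q * g j $ l))"
      by (subst sum.swap) (simp only: sum_distrib_left)
    also have "\<dots> = (\<Sum>q\<in>UNIV. (if q = l then 1 else 0) * (x q * c))"
      using c unfolding scaled_section_def by (intro sum.cong refl) auto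
    also have "\<dots> = c * x l" by (subst sum_indicator_mult) (rule mult.commute)
    finally show ?thesis .
  qed
  have w0g: "(\<Sum>j\<in>UNIV. w0 i j * g j $ l) = c * (\<Sum>p\<in>UNIV. \<theta> i p * T p l)" for i l
  proof -
    have "w0 i j = (\<Sum>q\<in>UNIV. (\<Sum>p\<in>UNIV. \<theta> i p * T p q) * \<theta> j q)" for j
      unfolding w0_def sum_distrib_right by (rule sum.swap)
    then show ?thesis by (simp only: sec)
  qed
  \<comment> \<open>The part of \<open>c\<^sup>2 h\<close> that is not yet a boundary; for fixed \<open>l\<close> it is a relation between the \<open>g i\<close>.\<close>
  define h' where "h' l i = c\<^sup>2 * h i $ l - (\<Sum>j\<in>UNIV. w0 i j * g j $ l)" for l i
  have "(\<Sum>i\<in>UNIV. h' l i * g i $ m) = 0" for l m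
  proof -
    have "(\<Sum>i\<in>UNIV. h' l i * g i $ m) =
        (\<Sum>i\<in>UNIV. c\<^sup>2 * (g i $ m * h i $ l) - c * ((\<Sum>p\<in>UNIV. T p l * \<theta> i p) * g i $ m))"
      unfolding h'_def w0g by (intro sum.cong refl) (simp add: algebra_simps)
    also have "\<dots> = c\<^sup>2 * T m l - c * (c * T m l)"
      by (simp only: sum_subtractf sum_distrib_left[symmetric] sec) (simp only: T_def)
    finally show ?thesis by (simp add: power2_eq_square mult.assoc)
  qed
  then have "\<exists>s. \<forall>i. h' l i = s * ?D i" for l
    using relations_are_multiples_of_signed_minors[OF a b reg] by metis
  then obtain s where s: "h' l i = s l * ?D i" for l i by metis
  define \<sigma> where "\<sigma> j = (\<Sum>q\<in>UNIV. s q * \<theta> j q)" for j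
  have \<sigma>g: "(\<Sum>j\<in>UNIV. \<sigma> j * g j $ l) = c * s l" for l
    unfolding \<sigma>_def by (rule sec)
  define w where "w i j = c * w0 i j + (?D i * \<sigma> j - ?D j * \<sigma> i)" for i j
  have "alternating w"
    unfolding alternating_def
  proof (intro conjI allI)
    show "w i i = 0" for i by (simp add: w_def alternating_diag[OF alt0])
    show "w i j = - w j i" for i j
      unfolding w_def by (subst alternating_swap[OF alt0]) simp
  qed
  moreover have "c ^ 3 * h i $ p = (\<Sum>j\<in>UNIV. w i j * g j $ p)" for i p
  proof -
    have "(\<Sum>j\<in>UNIV. w i j * g j $ p) =
        (\<Sum>j\<in>UNIV. c * (w0 i j * g j $ p) + (?D i * (\<sigma> j * g j $ p) - \<sigma> i * (?D j * g j $ p)))"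
      unfolding w_def by (intro sum.cong refl) (simp add: algebra_simps)
    also have "\<dots> = c * (\<Sum>j\<in>UNIV. w0 i j * g j $ p) + ?D i * (c * s p)"
      by (simp only: sum.distrib sum_subtractf sum_distrib_left[symmetric] \<sigma>g
          signed_minor_relation[OF a reg] mult_zero_right diff_zero)
    also have "\<dots> = c * ((\<Sum>j\<in>UNIV. w0 i j * g j $ p) + h' p i)"
      by (simp add: s distrib_left mult_ac)
    also have "\<dots> = c ^ 3 * h i $ p"
      by (simp add: h'_def power3_eq_cube power2_eq_square mult_ac)
    finally show ?thesis ..
  qed
  ultimately show thesis by (rule that)
qed

text \<open>
  Exactness of the quadratic complex in the middle. The Koszul representations of \<open>a\<^sup>3 h\<close> and
  \<open>b\<^sup>3 h\<close> agree after cross-multiplication by injectivity, so regularity of \<open>a\<^sup>3, b\<^sup>3\<close> lets one divide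
  the first of them by \<open>a\<^sup>3\<close>.
\<close>

lemma quadratic_relation_coefficients:
  fixes g h :: "'n::finite option \<Rightarrow> 'a::comm_ring_1 ^ 'n"
  assumes a: "scaled_section g a \<psi>" and b: "scaled_section g b \<psi>'" and reg: "regular_pair a b"
    and alt: "alternating (\<lambda>p q. \<Sum>i\<in>UNIV. g i $ p * h i $ q)"
  obtains w where "\<And>i. h i = (\<Sum>j\<in>UNIV. w i j *s g j)"
proof -
  obtain u where u: "alternating u" "\<And>i p. a ^ 3 * h i $ p = (\<Sum>j\<in>UNIV. u i j * g j $ p)"
    using scaled_koszul_relation[OF a b reg a alt] by blast
  obtain v where v: "alternating v" "\<And>i p. b ^ 3 * h i $ p = (\<Sum>j\<in>UNIV. v i j * g j $ p)"
    using scaled_koszul_relation[OF a b reg b alt] by blast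
  have "b ^ 3 * u i j - a ^ 3 * v i j = 0" for i j
  proof (rule alternating_syzygy_eq_0[OF a b reg])
    show "alternating (\<lambda>i j. b ^ 3 * u i j - a ^ 3 * v i j)"
      unfolding alternating_def
    proof (intro conjI allI)
      show "b ^ 3 * u i i - a ^ 3 * v i i = 0" for i
        by (simp add: alternating_diag[OF u(1)] alternating_diag[OF v(1)])
      show "b ^ 3 * u i j - a ^ 3 * v i j = - (b ^ 3 * u j i - a ^ 3 * v j i)" for i j
        by (subst alternating_swap[OF u(1)], subst alternating_swap[OF v(1)]) simp
    qed
    show "(\<Sum>j\<in>UNIV. (b ^ 3 * u i j - a ^ 3 * v i j) * g j $ p) = 0" for i p
      by (simp only: left_diff_distrib mult.assoc sum_subtractf sum_distrib_left[symmetric]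
          u(2)[symmetric] v(2)[symmetric]) (simp add: mult.left_commute)
  qed
  then have "a ^ 3 dvd b ^ 3 * u i j" for i j
    by (metis dvd_triv_left eq_iff_diff_eq_0)
  then have "a ^ 3 dvd u i j" for i j
    using regular_pairD2[OF regular_pair_power[OF reg]] by blast
  then obtain w where w: "u i j = a ^ 3 * w i j" for i j
    unfolding dvd_def by metis
  have "h i = (\<Sum>j\<in>UNIV. w i j *s g j)" for i
  proof (subst vec_eq_iff, intro allI, rule regular_pair_cancel[OF regular_pair_power_left[OF reg]])
    fix p
    show "a ^ 3 * h i $ p = a ^ 3 * (\<Sum>j\<in>UNIV. w i j *s g j) $ p"
      by (simp add: u(2) w sum_distrib_left mult.assoc)
  qed
  then show thesis by (rule that)
qed

section \<open>The symmetric algebra in low degrees\<close>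

lemma sym_lin_add: "sym_lin (x + y) = sym_lin x + sym_lin y"
  by (simp add: sym_lin_def single_add sum.distrib)

lemma sym_lin_0 [simp]: "sym_lin 0 = 0"
  by (simp add: sym_lin_def)

lemma sym_lin_scale: "sym_lin (c *s x) = sym_const c * sym_lin x"
  by (simp add: sym_lin_def sym_const_def sum_distrib_left mult_single)

lemma sym_lin_minus: "sym_lin (- x) = - sym_lin x"
  using sym_lin_add[of x "- x"] by (simp add: eq_neg_iff_add_eq_0 add.commute)

lemma sym_lin_diff: "sym_lin (x - y) = sym_lin x - sym_lin y"
  using sym_lin_add[of x "- y"] by (simp add: sym_lin_minus)

lemma sym_lin_sum: "sym_lin (\<Sum>i\<in>A. f i) = (\<Sum>i\<in>A. sym_lin (f i))"
  by (induction A rule: infinite_finite_induct) (simp_all add: sym_lin_add)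

lemma sym_lin_axis: "sym_lin (axis p c) = Poly_Mapping.single (Poly_Mapping.single p 1) c"
proof -
  have "Poly_Mapping.single (Poly_Mapping.single i (1::nat)) (axis p c $ i)
      = (if i = p then Poly_Mapping.single (Poly_Mapping.single p 1) c else 0)" for i
    by (simp add: axis_def)
  then show ?thesis by (simp add: sym_lin_def del: One_nat_def)
qed

lemma quadratic_exponent_eq_iff:
  "Poly_Mapping.single p 1 + Poly_Mapping.single q 1 =
     Poly_Mapping.single s 1 + Poly_Mapping.single t (1::nat) \<longleftrightarrow>
   (p = s \<and> q = t) \<or> (p = t \<and> q = s)" (is "?l = ?r \<longleftrightarrow> _")
proof
  assume "?l = ?r"
  then have "Poly_Mapping.lookup ?l k = Poly_Mapping.lookup ?r k" for k by simp
  from this[of p] this[of q] this[of s] show "(p = s \<and> q = t) \<or> (p = t \<and> q = s)"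
    by (auto simp: lookup_add lookup_single when_def split: if_splits)
qed (auto simp: add.commute)

lemma lookup_sym_lin_mult:
  "Poly_Mapping.lookup (sym_lin x * sym_lin y) (Poly_Mapping.single s 1 + Poly_Mapping.single t 1)
    = (if s = t then x $ s * y $ s else x $ s * y $ t + x $ t * y $ s)"
proof -
  have "Poly_Mapping.lookup (sym_lin x * sym_lin y) (Poly_Mapping.single s 1 + Poly_Mapping.single t 1)
    = (\<Sum>p\<in>UNIV. \<Sum>q\<in>UNIV. if (p = s \<and> q = t) \<or> (p = t \<and> q = s) then x $ p * y $ q else 0)"
    unfolding sym_lin_def sum_product lookup_sum mult_single lookup_single quadratic_exponent_eq_iff when_def ..
  also have "\<dots> = (\<Sum>p\<in>UNIV. (if p = s then x $ p * y $ t else 0) +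
      (if s \<noteq> t \<and> p = t then x $ p * y $ s else 0))"
  proof (intro sum.cong refl)
    fix p
    have "(if (p = s \<and> q = t) \<or> (p = t \<and> q = s) then x $ p * y $ q else 0) =
       (if q = t then (if p = s then x $ p * y $ t else 0) else 0) +
       (if q = s then (if s \<noteq> t \<and> p = t then x $ p * y $ s else 0) else 0)" for q
      by auto
    then show "(\<Sum>q\<in>UNIV. if (p = s \<and> q = t) \<or> (p = t \<and> q = s) then x $ p * y $ q else 0) =
      (if p = s then x $ p * y $ t else 0) + (if s \<noteq> t \<and> p = t then x $ p * y $ s else 0)"
      by (simp add: sum.distrib)
  qed
  also have "\<dots> = (if s = t then x $ s * y $ s else x $ s * y $ t + x $ t * y $ s)"
    by (cases "s = t") (simp_all add: sum.distrib)
  finally show ?thesis .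
qed

text \<open>
  The kernel of \<open>F \<otimes> F \<rightarrow> S\<^sub>2\<close> consists of the alternating tensors.
\<close>

lemma alternating_if_sym_lin_products_sum_0:
  fixes g h :: "'i \<Rightarrow> 'a::comm_ring_1 ^ 'n::finite"
  assumes "(\<Sum>i\<in>A. sym_lin (g i) * sym_lin (h i)) = 0"
  shows "alternating (\<lambda>p q. \<Sum>i\<in>A. g i $ p * h i $ q)"
proof -
  have L: "(\<Sum>i\<in>A. if s = t then g i $ s * h i $ s else g i $ s * h i $ t + g i $ t * h i $ s) = 0" for s t
    using arg_cong[OF assms, of "\<lambda>f. Poly_Mapping.lookup f (Poly_Mapping.single s 1 + Poly_Mapping.single t 1)"]
    by (simp only: lookup_sum lookup_sym_lin_mult lookup_zero)
  have diag: "(\<Sum>i\<in>A. g i $ s * h i $ s) = 0" for s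
    using L[of s s] by simp
  have "(\<Sum>i\<in>A. g i $ s * h i $ t) + (\<Sum>i\<in>A. g i $ t * h i $ s) = 0" for s t
    using L[of s t] diag[of s] by (cases "s = t") (simp_all add: sum.distrib)
  then show ?thesis
    unfolding alternating_def using diag by (simp add: eq_neg_iff_add_eq_0)
qed

text \<open>
  Exponent vectors cancel, so a monomial whose coefficient is a nonzerodivisor is a nonzerodivisor in
  the polynomial ring.
\<close>

lemma sym_monomial_mult_eq_0:
  fixes q :: "('a::comm_ring_1, 'n) sym_alg"
  assumes c: "\<And>y. c * y = 0 \<Longrightarrow> y = 0" and z: "q * Poly_Mapping.single u c = 0"
  shows "q = 0"
proof (rule poly_mapping_eqI)
  fix v
  have "c * Poly_Mapping.lookup q v = Poly_Mapping.lookup (Poly_Mapping.single u c * q) (u + v)"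
    by (simp add: lookup_mult lookup_single when_mult)
  also have "\<dots> = 0" using z by (simp add: mult.commute)
  finally show "Poly_Mapping.lookup q v = Poly_Mapping.lookup 0 v" using c by simp
qed

lemma submodule_prod_mono:
  "N \<subseteq> N' \<Longrightarrow> M \<subseteq> M' \<Longrightarrow> submodule_prod N M \<subseteq> submodule_prod N' M'"
  unfolding submodule_prod_def by (rule module.span_mono[OF module_sym]) blast

lemma submodule_prod_base: "x \<in> N \<Longrightarrow> y \<in> M \<Longrightarrow> sym_lin x * sym_lin y \<in> submodule_prod N M"
  unfolding submodule_prod_def by (rule module.span_base[OF module_sym]) blast

section \<open>Local rings of depth two\<close>

lemma subspace_ring_iff:
  "module.subspace ((*) :: 'a::comm_ring_1 \<Rightarrow> 'a \<Rightarrow> 'a) J \<longleftrightarrow>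
    0 \<in> J \<and> (\<forall>x\<in>J. \<forall>y\<in>J. x + y \<in> J) \<and> (\<forall>c. \<forall>x\<in>J. c * x \<in> J)"
  by (rule module.subspace_def[OF module_ring])

lemma subspace_vec_iff:
  "module.subspace ((*s) :: 'a::comm_ring_1 \<Rightarrow> 'a ^ 'n \<Rightarrow> 'a ^ 'n) U \<longleftrightarrow>
    0 \<in> U \<and> (\<forall>x\<in>U. \<forall>y\<in>U. x + y \<in> U) \<and> (\<forall>c. \<forall>x\<in>U. c *s x \<in> U)"
  by (rule module.subspace_def[OF module_vec])

lemma span_ring_pair: "module.span (*) {x, y} = {u * x + v * y | u v. True}" for x y :: "'a::comm_ring_1"
proof (rule set_eqI)
  fix z
  have "z \<in> module.span (*) {x, y} \<longleftrightarrow> (\<exists>u v. z - u * x = v * y)"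
    unfolding module.span_insert[OF module_ring, of x "{y}"]
      module.span_singleton[OF module_ring, of y] by auto
  then show "z \<in> module.span (*) {x, y} \<longleftrightarrow> z \<in> {u * x + v * y | u v. True}"
    by (simp add: diff_eq_eq add.commute)
qed

lemma span_ring_singleton: "module.span (*) {x} = {y. x dvd y}" for x :: "'a::comm_ring_1"
  using module.span_singleton[OF module_ring, of x] by (auto simp: dvd_def mult.commute)

lemma proper_ideal_subset_maximal:
  fixes J :: "'a::comm_ring_1 set"
  assumes J: "module.subspace (*) J" "1 \<notin> J"
  obtains P where "maximal_ideal_of_ring P" "J \<subseteq> P"
proof -
  let ?A = "{I. module.subspace (*) I \<and> J \<subseteq> I \<and> (1::'a) \<notin> I}"
  have "\<exists>P\<in>?A. \<forall>X\<in>?A. P \<subseteq> X \<longrightarrow> X = P"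
  proof (rule subset_Zorn_nonempty)
    show "?A \<noteq> {}" using J by blast
    fix C assume C: "C \<noteq> {}" "subset.chain ?A C"
    then have CA: "C \<subseteq> ?A" by (simp add: subset_chain_def)
    have sub: "0 \<in> X \<and> (\<forall>x\<in>X. \<forall>y\<in>X. x + y \<in> X) \<and> (\<forall>c. \<forall>x\<in>X. c * x \<in> X)" if "X \<in> C" for X
      using that CA unfolding subspace_ring_iff[symmetric] by blast
    have "module.subspace (*) (\<Union>C)"
      unfolding subspace_ring_iff
    proof (intro conjI ballI allI)
      show "0 \<in> \<Union>C" using C(1) sub by blast
      show "c * x \<in> \<Union>C" if "x \<in> \<Union>C" for c x
        using that sub by blast
      show "x + y \<in> \<Union>C" if xy: "x \<in> \<Union>C" "y \<in> \<Union>C" for x y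
      proof -
        obtain X Y where XY: "x \<in> X" "X \<in> C" "y \<in> Y" "Y \<in> C" using xy by blast
        then have "X \<subseteq> Y \<or> Y \<subseteq> X" using C(2) by (simp add: subset_chain_def)
        then obtain Z where Z: "Z \<in> C" "x \<in> Z" "y \<in> Z" using XY by blast
        with sub[OF Z(1)] show ?thesis by blast
      qed
    qed
    moreover have "J \<subseteq> \<Union>C" "1 \<notin> \<Union>C" using C(1) CA by blast+
    ultimately show "\<Union>C \<in> ?A" by blast
  qed
  then obtain P where P: "P \<in> ?A" "\<forall>X\<in>?A. P \<subseteq> X \<longrightarrow> X = P" by (rule bexE)
  have "I = P \<or> I = UNIV" if I: "module.subspace (*) I" "P \<subseteq> I" for I
  proof (cases "1 \<in> I")
    case True
    have "x * 1 \<in> I" for x using True I(1) unfolding subspace_ring_iff by blast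
    then have "x \<in> I" for x by simp
    then show ?thesis by blast
  next
    case False
    then have "I \<in> ?A" using P(1) I by blast
    from bspec[OF P(2) this] I(2) show ?thesis by simp
  qed
  then have "maximal_ideal_of_ring P" using P(1) unfolding maximal_ideal_of_ring_def by blast
  then show thesis using that P(1) by blast
qed

locale local_ring =
  fixes m :: "'a::comm_ring_1 set"
  assumes noeth_local: "noetherian_local_ring m"
begin

lemma max_ideal: "maximal_ideal_of_ring m"
proof -
  have "m \<in> {P. maximal_ideal_of_ring P}"
    using noeth_local unfolding noetherian_local_ring_def by simp
  then show ?thesis by simp
qed

lemma m_ideal: "module.subspace (*) m"
  using max_ideal unfolding maximal_ideal_of_ring_def by (rule conjunct1)

lemma m_0: "0 \<in> m"
  by (rule module.subspace_0[OF module_ring m_ideal])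

lemma m_add: "x \<in> m \<Longrightarrow> y \<in> m \<Longrightarrow> x + y \<in> m"
  by (rule module.subspace_add[OF module_ring m_ideal])

lemma m_mult: "x \<in> m \<Longrightarrow> c * x \<in> m"
  by (rule module.subspace_scale[OF module_ring m_ideal])

lemma m_mult_right: "x \<in> m \<Longrightarrow> x * c \<in> m"
  using m_mult[of x c] by (simp add: mult.commute)

lemma m_sum: "(\<And>i. i \<in> A \<Longrightarrow> f i \<in> m) \<Longrightarrow> (\<Sum>i\<in>A. f i) \<in> m"
  by (induction A rule: infinite_finite_induct) (auto simp: m_0 m_add)

lemma one_notin_m: "1 \<notin> m"
proof
  assume "1 \<in> m"
  then have "x \<in> m" for x using m_mult[of 1 x] by simp
  then have "m = UNIV" by blast
  then show False using max_ideal unfolding maximal_ideal_of_ring_def by simp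
qed

lemma dvd_one_if_notin_m:
  assumes "x \<notin> m" shows "x dvd 1"
proof (rule ccontr)
  assume n: "\<not> x dvd 1"
  have "module.subspace (*) {y. x dvd y}" by (simp add: subspace_ring_iff dvd_add)
  then obtain P where P: "maximal_ideal_of_ring P" "{y. x dvd y} \<subseteq> P"
    using proper_ideal_subset_maximal[of "{y. x dvd y}"] n by auto
  then have "P \<in> {P. maximal_ideal_of_ring P}" by simp
  then have "P = m" using noeth_local unfolding noetherian_local_ring_def by simp
  moreover have "x \<in> P" using P(2) by auto
  ultimately show False using assms by simp
qed

lemma not_dvd_one_if_in_m:
  assumes "x \<in> m" shows "\<not> x dvd 1"
proof
  assume "x dvd 1"
  then obtain u where "1 = x * u" by (rule dvdE)
  then have "1 \<in> m" by (rule ssubst) (rule m_mult_right[OF assms])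
  with one_notin_m show False by (rule notE)
qed

lemma unit_inverse:
  assumes "x \<notin> m" obtains u where "u * x = 1"
proof -
  obtain u where "1 = x * u" using dvd_one_if_notin_m[OF assms] by (rule dvdE)
  from this[symmetric] show thesis by (intro that[of u]) (subst mult.commute)
qed

lemma one_minus_notin_m: "c \<in> m \<Longrightarrow> 1 - c \<notin> m"
  using m_add[of c "1 - c"] one_notin_m by auto

lemma eq_0_if_eq_m_multiple:
  assumes "c \<in> m" "x = c * x" shows "x = 0"
proof -
  obtain u where u: "u * (1 - c) = 1" by (rule unit_inverse[OF one_minus_notin_m[OF assms(1)]])
  have "(1 - c) * x = 0" unfolding left_diff_distrib assms(2)[symmetric] by simp
  then have "u * (1 - c) * x = 0" by (simp only: mult.assoc mult_zero_right)
  then show ?thesis by (simp only: u mult_1_left)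
qed

lemma power_notin_m: "x \<notin> m \<Longrightarrow> x ^ k \<notin> m"
  using dvd_power_same[OF dvd_one_if_notin_m, of x k] not_dvd_one_if_in_m[of "x ^ k"]
  unfolding power_one by blast

text \<open>
  Nakayama's lemma for an explicit finite family of ring elements, by eliminating one element at a
  time.
\<close>

lemma nakayama_family:
  assumes "finite I"
    and "\<And>i j. c i j \<in> m"
    and "\<And>i. i \<in> I \<Longrightarrow> x i = (\<Sum>j\<in>I. c i j * x j)"
    and "i \<in> I"
  shows "x i = 0"
  using assms
proof (induction I arbitrary: i c rule: finite_induct)
  case (insert k A)
  note cm = insert.prems(1)
  have eq: "x i = c i k * x k + (\<Sum>j\<in>A. c i j * x j)" if "i \<in> insert k A" for i
    using insert.prems(2)[OF that] unfolding sum.insert[OF insert.hyps(1,2)] .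
  obtain u where u: "u * (1 - c k k) = 1" by (rule unit_inverse[OF one_minus_notin_m[OF cm]])
  have "(1 - c k k) * x k = x k - c k k * x k" by (simp only: left_diff_distrib mult_1_left)
  also have "\<dots> = (\<Sum>j\<in>A. c k j * x j)"
    unfolding diff_eq_eq by (subst add.commute) (rule eq[OF insertI1])
  finally have "u * ((1 - c k k) * x k) = u * (\<Sum>j\<in>A. c k j * x j)" by (rule arg_cong)
  then have xk: "x k = (\<Sum>j\<in>A. u * c k j * x j)"
    by (simp only: mult.assoc[symmetric] u mult_1_left sum_distrib_left)
  define d where "d i j = c i k * (u * c k j) + c i j" for i j
  have "x j = 0" if "j \<in> A" for j
  proof (rule insert.IH[OF _ _ that])
    show "d i j \<in> m" for i j
      unfolding d_def by (intro m_add m_mult cm)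
    fix i assume "i \<in> A"
    then have "x i = c i k * x k + (\<Sum>j\<in>A. c i j * x j)" by (intro eq insertI2)
    also have "c i k * x k = c i k * (\<Sum>j\<in>A. u * c k j * x j)" by (rule arg_cong[OF xk])
    finally show "x i = (\<Sum>j\<in>A. d i j * x j)"
      by (simp only: d_def sum_distrib_left sum.distrib distrib_right mult.assoc)
  qed
  moreover from this have "x k = 0" unfolding xk by (intro sum.neutral ballI) simp
  ultimately show ?case using insert.prems(3) by blast
qed simp

text \<open>
  Depth two in the form used throughout: a regular pair does not lie in a proper principal ideal.
\<close>

lemma regular_pair_no_common_divisor_in_m:
  assumes reg: "regular_pair x y" and t: "t \<in> m" "t dvd x" "t dvd y"
  shows False
proof -
  obtain x' where x: "x = t * x'" using t(2) by (rule dvdE)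
  obtain y' where y: "y = t * y'" using t(3) by (rule dvdE)
  have "y * x' = x * y'" by (simp only: x y mult_ac)
  then have "x dvd y * x'" by simp
  from regular_pairD2[OF reg this] obtain s where s: "x' = x * s" by (rule dvdE)
  have "x = t * (x * s)" unfolding s[symmetric] by (rule x)
  also have "\<dots> = (t * s) * x" by (simp only: mult_ac)
  finally have "x = (t * s) * x" .
  then have "x = 0" by (intro eq_0_if_eq_m_multiple[of "t * s"] m_mult_right t(1))
  then have "x * 1 = 0" by simp
  then have "(1 :: 'a) = 0" by (rule regular_pairD1[OF reg])
  then have "(1 :: 'a) \<in> m" by (rule ssubst) (rule m_0)
  with one_notin_m show False by (rule notE)
qed

end

lemma regular_sequence_first_two:
  assumes "regular_sequence xs" "length xs \<ge> 2"
  shows "regular_pair (xs ! 0) (xs ! 1)"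
proof (rule regular_pairI)
  have R: "y \<in> module.span (*) (set (take i xs))"
    if "i < length xs" "xs ! i * y \<in> module.span (*) (set (take i xs))" for i y
    using assms(1) that unfolding regular_sequence_def by blast
  show "y = 0" if "xs ! 0 * y = 0" for y
    using R[of 0 y] that assms(2) by (cases xs) (simp_all add: module.span_empty[OF module_ring])
  have one: "set (take 1 xs) = {xs ! 0}"
    using assms(2) by (cases xs) auto
  show "xs ! 0 dvd y" if "xs ! 0 dvd xs ! 1 * y" for y
    using R[of 1 y] that assms(2) unfolding one span_ring_singleton by simp
qed

lemma depth_two_regular_pair:
  assumes "ring_depth m = 2"
  obtains a b where "a \<in> m" "b \<in> m" "regular_pair a b"
proof -
  have "1 < ring_depth m" by (simp add: assms)
  then obtain xs where xs: "set xs \<subseteq> m" "regular_sequence xs" "1 < enat (length xs)"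
    unfolding ring_depth_def less_SUP_iff by blast
  then have "length xs \<ge> 2" by (simp add: one_enat_def)
  then have "0 < length xs" "1 < length xs" by linarith+
  then have "xs ! 0 \<in> set xs" "xs ! 1 \<in> set xs" by (blast intro: nth_mem)+
  with xs \<open>length xs \<ge> 2\<close> show thesis
    by (intro that[of "xs ! 0" "xs ! 1"] regular_sequence_first_two) auto
qed

section \<open>Multiplying the socle by the maximal ideal\<close>

text \<open>
  For \<open>r \<ge> 2\<close> every term of the determinant contains at least two entries of the \<open>g c\<close>.
\<close>

lemma signed_minor_mem_ideal:
  fixes g :: "'n::finite option \<Rightarrow> 'a::comm_ring_1 ^ 'n"
  assumes J: "module.subspace (*) J" and prods: "\<And>i j p q. g i $ p * g j $ q \<in> J"
    and card: "CARD('n) \<noteq> 1"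
  shows "signed_minor g i \<in> J"
proof -
  have "CARD('n) > 0" by simp
  with card obtain k where k: "CARD('n) = Suc (Suc k)" by (metis One_nat_def Suc_pred gr0_implies_Suc neq0_conv)
  then obtain p q :: 'n where pq: "p \<noteq> q" by (auto simp: card_Suc_eq)
  let ?X = "(\<chi> r c. case r of Some p \<Rightarrow> g c $ p | None \<Rightarrow> if c = i then 1 else 0) :: 'a ^ 'n option ^ 'n option"
  have summand: "of_int (sign \<sigma>) * (\<Prod>r\<in>UNIV. ?X $ r $ \<sigma> r) \<in> J" for \<sigma>
  proof -
    have "(\<Prod>r\<in>UNIV. ?X $ r $ \<sigma> r) =
        ?X $ None $ \<sigma> None * (g (\<sigma> (Some p)) $ p * (g (\<sigma> (Some q)) $ q *
          (\<Prod>r\<in>UNIV - {p} - {q}. g (\<sigma> (Some r)) $ r)))"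
      using pq by (simp add: prod_UNIV_option prod.remove[of UNIV p] prod.remove[of "UNIV - {p}" q])
    also have "\<dots> = (?X $ None $ \<sigma> None * (\<Prod>r\<in>UNIV - {p} - {q}. g (\<sigma> (Some r)) $ r)) *
        (g (\<sigma> (Some p)) $ p * g (\<sigma> (Some q)) $ q)"
      by (simp only: mult_ac)
    finally show ?thesis
      by (simp only: module.subspace_scale[OF module_ring J] prods)
  qed
  show ?thesis
    unfolding signed_minor_def det_def by (rule module.subspace_sum[OF module_ring J summand])
qed

text \<open>
  Finite colength of the span of the \<open>r + 1\<close> vectors \<open>g i\<close> enters in the form that every element of
  \<open>m\<close> has a power mapping \<open>F\<close> into the span; depth two enters through the regular pair \<open>a, b\<close>.
\<close>

locale presented_module = local_ring m
  for m :: "'a::comm_ring_1 set" +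
  fixes g :: "'n::finite option \<Rightarrow> 'a ^ 'n" and a b :: 'a
  assumes reg: "regular_pair a b" and a_m: "a \<in> m" and b_m: "b \<in> m"
    and entries: "g i $ p \<in> m"
    and cofinite: "x \<in> m \<Longrightarrow> \<exists>k. \<forall>v. \<exists>c. x ^ k *s v = (\<Sum>i\<in>UNIV. c i *s g i)"
begin

definition N :: "('a ^ 'n) set" where
  "N = {\<Sum>i\<in>UNIV. c i *s g i | c. True}"

abbreviation M :: "('a ^ 'n) set" where "M \<equiv> module_colon N m"

lemma N_I: "(\<Sum>i\<in>UNIV. c i *s g i) \<in> N"
  unfolding N_def by blast

lemma N_E: assumes "f \<in> N" obtains c where "f = (\<Sum>i\<in>UNIV. c i *s g i)"
  using assms unfolding N_def by blast

lemma g_N: "g i \<in> N"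
proof -
  have "(\<Sum>j\<in>UNIV. (if j = i then 1 else 0) *s g j) = g i"
    by (simp add: vec_eq_iff sum_indicator_mult)
  then show ?thesis using N_I[of "\<lambda>j. if j = i then 1 else 0"] by simp
qed

lemma N_add: assumes "x \<in> N" "y \<in> N" shows "x + y \<in> N"
proof -
  obtain c where c: "x = (\<Sum>i\<in>UNIV. c i *s g i)" using assms(1) by (rule N_E)
  obtain d where d: "y = (\<Sum>i\<in>UNIV. d i *s g i)" using assms(2) by (rule N_E)
  have "x + y = (\<Sum>i\<in>UNIV. (c i + d i) *s g i)"
    unfolding c d by (simp add: vec_eq_iff sum.distrib distrib_right)
  then show ?thesis by (simp only: N_I)
qed

lemma N_scale: assumes "x \<in> N" shows "c *s x \<in> N"
proof -
  obtain d where d: "x = (\<Sum>i\<in>UNIV. d i *s g i)" using assms by (rule N_E)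
  have "c *s x = (\<Sum>i\<in>UNIV. (c * d i) *s g i)"
    unfolding d by (simp add: vec_eq_iff sum_distrib_left mult.assoc)
  then show ?thesis by (simp only: N_I)
qed

lemma N_subspace: "module.subspace (*s) N"
  unfolding subspace_vec_iff using N_I[of "\<lambda>_. 0"] N_add N_scale by auto

lemma N_entries: assumes "f \<in> N" shows "f $ p \<in> m"
proof -
  obtain c where c: "f = (\<Sum>i\<in>UNIV. c i *s g i)" using assms by (rule N_E)
  have "(\<Sum>i\<in>UNIV. c i * g i $ p) \<in> m" by (intro m_sum m_mult entries)
  then show ?thesis by (simp add: c)
qed

lemma N_subset_M: "N \<subseteq> M"
  unfolding module_colon_def using N_scale by blast

lemma M_D: "f \<in> M \<Longrightarrow> x \<in> m \<Longrightarrow> x *s f \<in> N"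
  unfolding module_colon_def by blast

lemma scaled_section_power:
  assumes "x \<in> m" obtains k \<psi> where "scaled_section g (x ^ k) \<psi>"
proof -
  obtain k where k: "\<And>v. \<exists>c. x ^ k *s v = (\<Sum>i\<in>UNIV. c i *s g i)"
    using cofinite[OF assms] by blast
  then obtain C where C: "\<And>v. x ^ k *s v = (\<Sum>i\<in>UNIV. C v i *s g i)" by metis
  have "(\<Sum>i\<in>UNIV. C (axis p 1) i * g i $ q) = (if p = q then x ^ k else 0)" for p q
  proof -
    have "(\<Sum>i\<in>UNIV. C (axis p 1) i * g i $ q) = (x ^ k *s axis p 1) $ q"
      unfolding C by simp
    then show ?thesis by (simp add: axis_def)
  qed
  then have "scaled_section g (x ^ k) (\<lambda>i p. C (axis p 1) i)"
    unfolding scaled_section_def by blast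
  then show thesis by (rule that)
qed

lemma relation_multiple:
  assumes "\<And>p. (\<Sum>i\<in>UNIV. k i * g i $ p) = 0"
  obtains s where "\<And>i. k i = s * signed_minor g i"
proof -
  obtain e \<psi> where s1: "scaled_section g (a ^ e) \<psi>" using a_m by (rule scaled_section_power)
  obtain l \<psi>' where s2: "scaled_section g (b ^ l) \<psi>'" using b_m by (rule scaled_section_power)
  show thesis
    by (rule relations_are_multiples_of_signed_minors[OF s1 s2 regular_pair_power[OF reg] assms that])
qed

lemma quadratic_relation:
  assumes "(\<Sum>i\<in>UNIV. sym_lin (g i) * sym_lin (h i)) = 0"
  shows "h i \<in> N"
proof -
  obtain e \<psi> where s1: "scaled_section g (a ^ e) \<psi>" using a_m by (rule scaled_section_power)
  obtain l \<psi>' where s2: "scaled_section g (b ^ l) \<psi>'" using b_m by (rule scaled_section_power)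
  obtain w where w: "\<And>i. h i = (\<Sum>j\<in>UNIV. w i j *s g j)"
    by (rule quadratic_relation_coefficients[OF s1 s2 regular_pair_power[OF reg]
          alternating_if_sym_lin_products_sum_0[OF assms]]) (rule that)
  show ?thesis unfolding w by (rule N_I)
qed

text \<open>
  The condition \<open>m M \<subseteq> m N\<close>, phrased with coefficients.
\<close>

definition socle_tight :: bool where
  "socle_tight \<longleftrightarrow> (\<forall>f\<in>M. \<forall>x\<in>m. \<exists>c. (\<forall>i. c i \<in> m) \<and> x *s f = (\<Sum>i\<in>UNIV. c i *s g i))"

lemma socle_tightE:
  assumes "socle_tight" "f \<in> M" "x \<in> m"
  obtains c where "\<And>i. c i \<in> m" "x *s f = (\<Sum>i\<in>UNIV. c i *s g i)"
proof -
  have "\<exists>c. (\<forall>i. c i \<in> m) \<and> x *s f = (\<Sum>i\<in>UNIV. c i *s g i)"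
    by (rule assms(1)[unfolded socle_tight_def, THEN bspec, OF assms(2), THEN bspec, OF assms(3)])
  then show thesis
  proof (elim exE conjE)
    fix c assume "\<forall>i. c i \<in> m" "x *s f = (\<Sum>i\<in>UNIV. c i *s g i)"
    then show thesis by (intro that[of c]) simp_all
  qed
qed

text \<open>
  With \<open>z f = \<Sum> w'\<^sub>j g\<^sub>j\<close>, the vector \<open>x w' - z w\<close> is a relation between the generators and hence a
  multiple of the vector of minors. Solving its \<open>i\<close>-th entry for \<open>z\<close> is possible as \<open>w i\<close> is a unit.
\<close>

lemma maximal_ideal_generators:
  assumes f: "f \<in> M" and x: "x \<in> m" and xf: "x *s f = (\<Sum>j\<in>UNIV. w j *s g j)"
    and w: "w i \<notin> m" and z: "z \<in> m"
  shows "\<exists>u v. z = u * x + v * signed_minor g i"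
proof -
  obtain w' where zf: "z *s f = (\<Sum>j\<in>UNIV. w' j *s g j)" using M_D[OF f z] by (rule N_E)
  have "(\<Sum>j\<in>UNIV. (x * w' j - z * w j) * g j $ p) = 0" for p
  proof -
    have "(\<Sum>j\<in>UNIV. (x * w' j - z * w j) * g j $ p)
        = x * (\<Sum>j\<in>UNIV. w' j *s g j) $ p - z * (\<Sum>j\<in>UNIV. w j *s g j) $ p"
      by (simp add: left_diff_distrib sum_subtractf sum_distrib_left mult.assoc)
    also have "\<dots> = 0" unfolding xf[symmetric] zf[symmetric] by (simp add: mult.left_commute)
    finally show ?thesis .
  qed
  then obtain s where s: "\<And>j. x * w' j - z * w j = s * signed_minor g j"
    by (rule relation_multiple) blast
  obtain u where u: "u * w i = 1" using w by (rule unit_inverse)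
  have "z * w i = x * w' i - s * signed_minor g i"
    unfolding s[of i, symmetric] by simp
  then have "u * (z * w i) = u * (x * w' i - s * signed_minor g i)" by (rule arg_cong)
  moreover have "u * (z * w i) = (u * w i) * z" by (simp only: mult_ac)
  ultimately have "z = u * (x * w' i - s * signed_minor g i)" by (simp only: u mult_1_left)
  also have "\<dots> = (u * w' i) * x + (- u * s) * signed_minor g i"
    by (simp add: algebra_simps)
  finally show ?thesis by blast
qed

lemma not_socle_tight:
  assumes "\<not> socle_tight"
  obtains f x w i where "f \<in> M" "x \<in> m" "x *s f = (\<Sum>j\<in>UNIV. w j *s g j)" "w i \<notin> m"
    "\<And>z. z \<in> m \<Longrightarrow> \<exists>u v. z = u * x + v * signed_minor g i"
proof -
  obtain f x where fx: "f \<in> M" "x \<in> m"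
    and n: "\<nexists>c. (\<forall>i. c i \<in> m) \<and> x *s f = (\<Sum>i\<in>UNIV. c i *s g i)"
    using assms unfolding socle_tight_def by blast
  obtain w where w: "x *s f = (\<Sum>j\<in>UNIV. w j *s g j)" using M_D[OF fx] by (rule N_E)
  with n obtain i where i: "w i \<notin> m" by blast
  show thesis
    by (rule that[OF fx w i]) (rule maximal_ideal_generators[OF fx w i])
qed

text \<open>
  For \<open>r \<ge> 2\<close> the minor \<open>\<Delta>\<close> with \<open>m = (x, \<Delta>)\<close> lies in \<open>m\<^sup>2 \<subseteq> (x) + m \<Delta>\<close>, so that \<open>\<Delta> \<in> (x)\<close> and
  \<open>m\<close> would be principal.
\<close>

lemma rank_one_if_not_socle_tight:
  assumes "\<not> socle_tight" shows "CARD('n) = 1"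
proof (rule ccontr)
  assume card: "CARD('n) \<noteq> 1"
  obtain f x w i where "f \<in> M" and x: "x \<in> m"
    and "x *s f = (\<Sum>j\<in>UNIV. w j *s g j)" "w i \<notin> m"
    and gen: "\<And>z. z \<in> m \<Longrightarrow> \<exists>u v. z = u * x + v * signed_minor g i"
    using assms by (rule not_socle_tight) (rule that)
  let ?D = "signed_minor g i"
  \<comment> \<open>The ideal \<open>(x) + m \<Delta>\<close>, which contains \<open>m\<^sup>2\<close>.\<close>
  define J where "J = {p * x + c * ?D | p c. c \<in> m}"
  have J_I: "p * x + c * ?D \<in> J" if "c \<in> m" for p c using that unfolding J_def by blast
  have "module.subspace (*) J"
    unfolding subspace_ring_iff
  proof (intro conjI ballI allI)
    show "0 \<in> J" using J_I[OF m_0, of 0] by simp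
    fix y assume "y \<in> J"
    then obtain p c where y: "y = p * x + c * ?D" "c \<in> m" unfolding J_def by blast
    show "d * y \<in> J" for d
      using J_I[OF m_mult[OF y(2)], of "d * p" d] unfolding y(1) by (simp add: algebra_simps)
    fix z assume "z \<in> J"
    then obtain q d where z: "z = q * x + d * ?D" "d \<in> m" unfolding J_def by blast
    show "y + z \<in> J"
      using J_I[OF m_add[OF y(2) z(2)], of "p + q"] unfolding y(1) z(1) by (simp add: algebra_simps)
  qed
  moreover have "g j $ p * g k $ q \<in> J" for j k p q
  proof -
    obtain u v where uv: "g j $ p = u * x + v * ?D" using gen[OF entries] by blast
    have "g j $ p * g k $ q = (u * g k $ q) * x + (v * g k $ q) * ?D"
      unfolding uv by (simp add: algebra_simps)
    moreover have "v * g k $ q \<in> m" by (intro m_mult entries)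
    ultimately show ?thesis using J_I by simp
  qed
  ultimately have "?D \<in> J" using card by (rule signed_minor_mem_ideal)
  then obtain p c where D: "?D = p * x + c * ?D" and c: "c \<in> m" unfolding J_def by blast
  obtain u where u: "u * (1 - c) = 1" by (rule unit_inverse[OF one_minus_notin_m[OF c]])
  have "(1 - c) * ?D = ?D - c * ?D" by (simp only: left_diff_distrib mult_1_left)
  also have "\<dots> = p * x" unfolding diff_eq_eq by (rule D)
  finally have "u * ((1 - c) * ?D) = u * (p * x)" by (rule arg_cong)
  then have "?D = u * p * x" by (simp only: mult.assoc[symmetric] u mult_1_left)
  then have xD: "x dvd ?D" by simp
  have "x dvd z" if "z \<in> m" for z
    using gen[OF that] xD by (auto intro!: dvd_add)
  then show False
    using regular_pair_no_common_divisor_in_m[OF reg x] a_m b_m by blast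
qed

text \<open>
  If an entry of \<open>f\<close> were a unit, reading off this entry from \<open>m f \<subseteq> m N\<close> would give \<open>m \<subseteq> m\<^sup>2\<close>.
\<close>

lemma M_entries_if_socle_tight:
  assumes tight: "socle_tight" and f: "f \<in> M"
  shows "f $ p \<in> m"
proof (rule ccontr)
  assume "f $ p \<notin> m"
  then obtain u where u: "u * f $ p = 1" by (rule unit_inverse)
  have m_comb: "\<exists>c. (\<forall>i. c i \<in> m) \<and> x = (\<Sum>i\<in>UNIV. c i * g i $ p)" if "x \<in> m" for x
  proof -
    obtain c where c: "\<And>i. c i \<in> m" "x *s f = (\<Sum>i\<in>UNIV. c i *s g i)"
      using tight f \<open>x \<in> m\<close> by (rule socle_tightE) (rule that)
    have "x = u * (x *s f) $ p" by (simp add: mult.left_commute[of u] u)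
    also have "\<dots> = (\<Sum>i\<in>UNIV. (u * c i) * g i $ p)"
      unfolding c(2) by (simp add: sum_distrib_left mult.assoc)
    finally show ?thesis by (intro exI[of _ "\<lambda>i. u * c i"] conjI allI m_mult c(1))
  qed
  then have "\<forall>i. \<exists>c. (\<forall>j. c j \<in> m) \<and> g i $ p = (\<Sum>j\<in>UNIV. c j * g j $ p)"
    using entries by blast
  from choice[OF this] obtain C
    where C: "\<forall>i. (\<forall>j. C i j \<in> m) \<and> g i $ p = (\<Sum>j\<in>UNIV. C i j * g j $ p)" by (rule exE)
  have g0: "g i $ p = 0" for i
  proof (rule nakayama_family[of UNIV C "\<lambda>i. g i $ p"])
    show "C i j \<in> m" for i j using C by blast
    show "g i $ p = (\<Sum>j\<in>UNIV. C i j * g j $ p)" for i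
      by (rule C[THEN spec, THEN conjunct2])
  qed simp_all
  have "x = 0" if "x \<in> m" for x
    using m_comb[OF that] by (simp add: g0)
  then have "0 dvd a" "0 dvd b" using a_m b_m by simp_all
  then show False by (rule regular_pair_no_common_divisor_in_m[OF reg m_0])
qed

text \<open>
  The linkage argument for \<open>M\<^sup>2 = N M\<close>: writing \<open>f h = \<Sum> g\<^sub>i \<alpha>\<^sub>i\<close>, membership of the \<open>\<alpha>\<^sub>i\<close> in the
  socle module is tested by multiplying with \<open>x \<in> m\<close> and invoking the quadratic relations.
\<close>

lemma socle_square_if_socle_tight:
  assumes tight: "socle_tight"
  shows "submodule_prod M M = submodule_prod N M"
proof
  show "submodule_prod N M \<subseteq> submodule_prod M M"
    by (rule submodule_prod_mono[OF N_subset_M order_refl])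
  have "sym_lin f * sym_lin h \<in> submodule_prod N M" if f: "f \<in> M" and h: "h \<in> M" for f h
  proof -
    have "\<exists>u. f $ p *s h = (\<Sum>i\<in>UNIV. u i *s g i)" for p
      using M_D[OF h M_entries_if_socle_tight[OF tight f]] unfolding N_def mem_Collect_eq by simp
    then have "\<forall>p. \<exists>u. f $ p *s h = (\<Sum>i\<in>UNIV. u i *s g i)" ..
    from choice[OF this] obtain u where "\<forall>p. f $ p *s h = (\<Sum>i\<in>UNIV. u p i *s g i)" by (rule exE)
    then have u: "f $ p *s h = (\<Sum>i\<in>UNIV. u p i *s g i)" for p by (rule spec)
    \<comment> \<open>\<open>f h = \<Sum> e\<^sub>p (f\<^sub>p h)\<close> with \<open>f\<^sub>p \<in> m\<close>, so \<open>f\<^sub>p h \<in> N\<close>; collecting by generators gives \<open>\<alpha>\<close>.\<close>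
    define \<alpha> where "\<alpha> i = (\<chi> p. u p i)" for i
    have lin: "sym_lin x = (\<Sum>p\<in>UNIV. sym_const (x $ p) * sym_lin (axis p 1))" for x :: "'a ^ 'n"
      unfolding sym_lin_axis sym_const_def mult_single by (simp add: sym_lin_def)
    have "sym_lin f * sym_lin h = (\<Sum>p\<in>UNIV. sym_lin (axis p 1) * sym_lin (f $ p *s h))"
      by (subst (1) lin, subst sum_distrib_right) (simp only: sym_lin_scale mult_ac)
    also have "\<dots> = (\<Sum>p\<in>UNIV. \<Sum>i\<in>UNIV. sym_lin (g i) * (sym_const (u p i) * sym_lin (axis p 1)))"
      unfolding u sym_lin_sum sym_lin_scale sum_distrib_left by (simp only: mult_ac)
    also have "\<dots> = (\<Sum>i\<in>UNIV. sym_lin (g i) * sym_lin (\<alpha> i))"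
    proof (subst sum.swap, intro sum.cong refl)
      fix i
      have "sym_lin (\<alpha> i) = (\<Sum>p\<in>UNIV. sym_const (u p i) * sym_lin (axis p 1))"
        by (subst lin) (simp only: \<alpha>_def vec_lambda_beta)
      then show "(\<Sum>p\<in>UNIV. sym_lin (g i) * (sym_const (u p i) * sym_lin (axis p 1))) =
          sym_lin (g i) * sym_lin (\<alpha> i)"
        by (simp only: sum_distrib_left)
    qed
    finally have fh: "sym_lin f * sym_lin h = (\<Sum>i\<in>UNIV. sym_lin (g i) * sym_lin (\<alpha> i))" .
    have "\<alpha> i \<in> M" for i
      unfolding module_colon_def
    proof (intro CollectI ballI)
      fix x assume x: "x \<in> m"
      obtain c where c: "\<And>i. c i \<in> m" "x *s f = (\<Sum>i\<in>UNIV. c i *s g i)"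
        using tight f x by (rule socle_tightE) (rule that)
      have "(\<Sum>i\<in>UNIV. sym_lin (g i) * sym_lin (x *s \<alpha> i - c i *s h))
          = sym_const x * (\<Sum>i\<in>UNIV. sym_lin (g i) * sym_lin (\<alpha> i))
            - (\<Sum>i\<in>UNIV. sym_const (c i) * sym_lin (g i)) * sym_lin h"
        by (simp add: sym_lin_diff sym_lin_scale right_diff_distrib sum_subtractf
            sum_distrib_left sum_distrib_right mult_ac)
      also have "(\<Sum>i\<in>UNIV. sym_const (c i) * sym_lin (g i)) = sym_const x * sym_lin f"
        by (simp only: sym_lin_scale[symmetric] sym_lin_sum[symmetric] c(2))
      finally have "(\<Sum>i\<in>UNIV. sym_lin (g i) * sym_lin (x *s \<alpha> i - c i *s h)) = 0"
        by (simp add: fh[symmetric] mult.assoc)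
      then have "x *s \<alpha> i - c i *s h \<in> N" by (rule quadratic_relation)
      from N_add[OF this M_D[OF h c(1)[of i]]] show "x *s \<alpha> i \<in> N" by simp
    qed
    then show ?thesis
      unfolding fh submodule_prod_def
      by (intro module.span_sum[OF module_sym] module.span_base[OF module_sym]) (use g_N in blast)
  qed
  then show "submodule_prod M M \<subseteq> submodule_prod N M"
    unfolding submodule_prod_def[of M M]
    by (intro module.span_minimal[OF module_sym])
      (auto simp: submodule_prod_def intro!: module.subspace_span[OF module_sym])
qed

end

section \<open>Ideals containing a regular parameter\<close>

text \<open>
  The ideal \<open>(x\<^sup>j, t)\<close>. Membership for varying \<open>j\<close> plays the role of a valuation modulo \<open>t\<close>.
\<close>

definition power_plus :: "'a::comm_ring_1 \<Rightarrow> 'a \<Rightarrow> nat \<Rightarrow> 'a set" where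
  "power_plus x t j = {s * x ^ j + c * t | s c. True}"

lemma power_plusI: "s * x ^ j + c * t \<in> power_plus x t j"
  unfolding power_plus_def by blast

lemma power_plusE:
  assumes "z \<in> power_plus x t j" obtains s c where "z = s * x ^ j + c * t"
  using assms unfolding power_plus_def by blast

lemma subspace_power_plus: "module.subspace (*) (power_plus x t j)"
  unfolding subspace_ring_iff
proof (intro conjI ballI allI)
  show "0 \<in> power_plus x t j" using power_plusI[of 0 x j 0 t] by simp
  fix y assume "y \<in> power_plus x t j"
  then obtain s c where y: "y = s * x ^ j + c * t" by (rule power_plusE)
  show "d * y \<in> power_plus x t j" for d
    using power_plusI[of "d * s" x j "d * c" t] unfolding y by (simp add: algebra_simps)
  fix z assume "z \<in> power_plus x t j"
  then obtain s' c' where z: "z = s' * x ^ j + c' * t" by (rule power_plusE)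
  show "y + z \<in> power_plus x t j"
    using power_plusI[of "s + s'" x j "c + c'" t] unfolding y z by (simp add: algebra_simps)
qed

lemma power_plus_mult:
  assumes "y \<in> power_plus x t j" "z \<in> power_plus x t k"
  shows "y * z \<in> power_plus x t (j + k)"
proof -
  obtain s c where y: "y = s * x ^ j + c * t" using assms(1) by (rule power_plusE)
  obtain s' c' where z: "z = s' * x ^ k + c' * t" using assms(2) by (rule power_plusE)
  have "y * z = (s * s') * x ^ (j + k) + (s * x ^ j * c' + c * (s' * x ^ k + c' * t)) * t"
    unfolding y z by (simp add: algebra_simps power_add)
  then show ?thesis by (simp only: power_plusI)
qed

lemma power_plus_power: "z \<in> power_plus x t j \<Longrightarrow> z ^ k \<in> power_plus x t (j * k)"
proof (induction k)
  case 0
  show ?case using power_plusI[of 1 x 0 0 t] by simp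
next
  case (Suc k)
  then show ?case using power_plus_mult[of z x t j "z ^ k" "j * k"] by simp
qed

lemma power_plus_antimono:
  assumes "j \<le> k" shows "power_plus x t k \<subseteq> power_plus x t j"
proof
  fix z assume "z \<in> power_plus x t k"
  then obtain s c where z: "z = s * x ^ k + c * t" by (rule power_plusE)
  have "z = (s * x ^ (k - j)) * x ^ j + c * t"
    unfolding z using assms by (simp add: mult.assoc power_add[symmetric])
  then show "z \<in> power_plus x t j" by (simp only: power_plusI)
qed

lemma ideal_power_subset_power_plus:
  assumes "Q \<subseteq> power_plus x t n"
  shows "ideal_power Q k \<subseteq> power_plus x t (n * k)"
proof (induction k)
  case 0
  have "z \<in> power_plus x t 0" for z using power_plusI[of z x 0 0 t] by simp
  then show ?case by auto
next
  case (Suc k)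
  have "y * z \<in> power_plus x t (n * Suc k)" if "y \<in> Q" "z \<in> ideal_power Q k" for y z
    using power_plus_mult[of y x t n z "n * k"] that assms Suc by auto
  then show ?case
    unfolding ideal_power.simps
    by (intro module.span_minimal[OF module_ring] subspace_power_plus) blast
qed

lemma power_cong_dvd:
  fixes t :: "'a::comm_ring_1"
  assumes "t dvd y - z" shows "t dvd y ^ k - z ^ k"
proof (induction k)
  case (Suc k)
  have "y ^ Suc k - z ^ Suc k = y * (y ^ k - z ^ k) + (y - z) * z ^ k"
    by (simp add: algebra_simps)
  then show ?case using Suc assms by (simp add: dvd_add)
qed simp

lemma subset_ideal_integral_closure: "Q \<subseteq> ideal_integral_closure Q"
proof
  fix z assume z: "z \<in> Q"
  have "z * (- 1) \<in> ideal_power Q (Suc 0)"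
    unfolding ideal_power.simps using z by (intro module.span_base[OF module_ring]) blast
  then show "z \<in> ideal_integral_closure Q"
    unfolding ideal_integral_closure_def
    by (intro CollectI exI[of _ "1::nat"] conjI exI[of _ "\<lambda>_. - z"]) simp_all
qed

context local_ring
begin

text \<open>
  The factor \<open>s\<close> is a unit, so \<open>z\<close> and \<open>x\<^sup>j\<close> generate the same ideal modulo \<open>t\<close>. The exponent is the
  last \<open>j\<close> with \<open>z \<in> (x\<^sup>j, t)\<close>.
\<close>

lemma not_in_power_plus:
  assumes gen: "\<And>z. z \<in> m \<Longrightarrow> \<exists>u v. z = u * x + v * t"
    and "z \<notin> power_plus x t n"
  obtains j s c where "j < n" "s \<notin> m" "z = s * x ^ j + c * t"
  using assms(2)
proof (induction n arbitrary: thesis)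
  case 0
  have "z = z * x ^ 0 + 0 * t" by simp
  then have "z \<in> power_plus x t 0" using power_plusI by metis
  with 0 show ?case by blast
next
  case (Suc n)
  show ?case
  proof (cases "z \<in> power_plus x t n")
    case True
    then obtain s c where z: "z = s * x ^ n + c * t" by (rule power_plusE)
    have "s \<notin> m"
    proof
      assume "s \<in> m"
      then obtain u v where s: "s = u * x + v * t" using gen by blast
      have "z = u * x ^ Suc n + (v * x ^ n + c) * t"
        unfolding z s by (simp add: algebra_simps)
      then have "z \<in> power_plus x t (Suc n)" by (simp only: power_plusI)
      with Suc.prems(2) show False by (rule notE)
    qed
    then show ?thesis by (intro Suc.prems(1)[OF _ _ z]) simp_all
  next
    case False
    show ?thesis
      by (rule Suc.IH[OF _ False]) (rule Suc.prems(1), simp_all)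
  qed
qed

text \<open>
  Let \<open>n\<close> be least with \<open>x\<^sup>n \<in> Q\<close>; then \<open>Q = (x\<^sup>n, t)\<close>. If \<open>z\<close> is integral over \<open>Q\<close> of order
  \<open>j < n\<close> modulo \<open>t\<close>, then in an integral equation of degree \<open>k\<close> the term \<open>z\<^sup>k\<close> has order exactly \<open>j k\<close>
  while all others have order at least \<open>j k + 1\<close>; hence \<open>x\<^sup>j\<^sup>k \<in> (t)\<close>, which is excluded.
\<close>

lemma integrally_closed_ideal_if_contains_parameter:
  assumes gen: "\<And>z. z \<in> m \<Longrightarrow> \<exists>u v. z = u * x + v * t"
    and x: "x \<in> m" and nd: "\<And>e. \<not> t dvd x ^ e"
    and Q: "module.subspace (*) Q" and t: "t \<in> Q" and xQ: "x ^ e \<in> Q"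
  shows "integrally_closed_ideal Q"
proof -
  define n where "n = (LEAST e. x ^ e \<in> Q)"
  have n: "x ^ n \<in> Q" unfolding n_def using xQ by (rule LeastI)
  have least: "n \<le> j" if "x ^ j \<in> Q" for j unfolding n_def using that by (rule Least_le)
  have Q_scale: "c * y \<in> Q" if "y \<in> Q" for c y
    using module.subspace_scale[OF module_ring Q that] .
  have sub: "power_plus x t n \<subseteq> Q"
    using n t Q_scale module.subspace_add[OF module_ring Q] by (auto elim!: power_plusE)
  have sup: "Q \<subseteq> power_plus x t n"
  proof
    fix z assume z: "z \<in> Q"
    show "z \<in> power_plus x t n"
    proof (rule ccontr)
      assume nin: "z \<notin> power_plus x t n"
      obtain j s c where j: "j < n" and s: "s \<notin> m" and zj: "z = s * x ^ j + c * t"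
        by (rule not_in_power_plus[OF gen nin], assumption) (rule that)
      obtain u where u: "u * s = 1" using s by (rule unit_inverse)
      have "s * x ^ j = z - c * t" unfolding zj by simp
      then have "u * (s * x ^ j) = u * (z - c * t)" by (rule arg_cong)
      then have "x ^ j = u * (z - c * t)" by (simp only: mult.assoc[symmetric] u mult_1_left)
      moreover have "u * (z - c * t) \<in> Q"
        by (intro Q_scale module.subspace_diff[OF module_ring Q] z t)
      ultimately have "x ^ j \<in> Q" by (rule ssubst)
      with least[of j] j show False by simp
    qed
  qed
  have "z \<in> Q" if "z \<in> ideal_integral_closure Q" for z
  proof (rule ccontr)
    assume "z \<notin> Q"
    then have nin: "z \<notin> power_plus x t n" using sub by blast
    obtain j s c where j: "j < n" and s: "s \<notin> m" and zj: "z = s * x ^ j + c * t"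
      by (rule not_in_power_plus[OF gen nin], assumption) (rule that)
    from \<open>z \<in> ideal_integral_closure Q\<close> obtain k w where k: "k > 0"
      and w: "\<forall>i\<in>{1..k}. w i \<in> ideal_power Q i"
      and eq: "z ^ k + (\<Sum>i=1..k. w i * z ^ (k - i)) = 0"
      unfolding ideal_integral_closure_def by blast
    have zP: "z \<in> power_plus x t j" unfolding zj by (rule power_plusI)
    have "w i * z ^ (k - i) \<in> power_plus x t (j * k + 1)" if i: "i \<in> {1..k}" for i
    proof -
      have "w i \<in> power_plus x t (n * i)"
        using ideal_power_subset_power_plus[OF sup] w i by blast
      then have "w i * z ^ (k - i) \<in> power_plus x t (n * i + j * (k - i))"
        using power_plus_power[OF zP] by (rule power_plus_mult)
      moreover have "j * k + 1 \<le> n * i + j * (k - i)"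
      proof -
        have "Suc j * i \<le> n * i" using j by (intro mult_le_mono1) simp
        moreover have "j * k = j * i + j * (k - i)"
          using i by (simp add: distrib_left[symmetric])
        ultimately show ?thesis using i by simp
      qed
      ultimately show ?thesis using power_plus_antimono by blast
    qed
    then have "(\<Sum>i=1..k. w i * z ^ (k - i)) \<in> power_plus x t (j * k + 1)"
      by (rule module.subspace_sum[OF module_ring subspace_power_plus])
    then have "- (\<Sum>i=1..k. w i * z ^ (k - i)) \<in> power_plus x t (j * k + 1)"
      by (rule module.subspace_neg[OF module_ring subspace_power_plus])
    moreover have "z ^ k = - (\<Sum>i=1..k. w i * z ^ (k - i))"
      using eq by (simp only: eq_neg_iff_add_eq_0)
    ultimately have "z ^ k \<in> power_plus x t (j * k + 1)" by (simp only:)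
    then obtain v d where v: "z ^ k = v * x ^ (j * k + 1) + d * t" by (rule power_plusE)
    have "t dvd z ^ k - (s * x ^ j) ^ k"
      by (rule power_cong_dvd) (simp add: zj)
    then obtain d' where "z ^ k - (s * x ^ j) ^ k = t * d'" by (rule dvdE)
    then have "v * x ^ (j * k + 1) + d * t - s ^ k * x ^ (j * k) = t * d'"
      by (simp only: v power_mult_distrib power_mult)
    then have "(s ^ k - v * x) * x ^ (j * k) = (d - d') * t"
      by (simp add: algebra_simps)
    moreover have "s ^ k - v * x \<notin> m"
    proof
      assume "s ^ k - v * x \<in> m"
      from m_add[OF this m_mult[OF x, of v]] have "s ^ k \<in> m" by simp
      with power_notin_m[OF s] show False by (rule notE)
    qed
    then obtain u where u: "u * (s ^ k - v * x) = 1" by (rule unit_inverse)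
    ultimately have "u * ((s ^ k - v * x) * x ^ (j * k)) = u * ((d - d') * t)" by simp
    then have "x ^ (j * k) = u * (d - d') * t" by (simp only: mult.assoc[symmetric] u mult_1_left)
    then have "t dvd x ^ (j * k)" by simp
    with nd show False by (rule notE)
  qed
  then have "ideal_integral_closure Q = Q" using subset_ideal_integral_closure by blast
  then show ?thesis using Q unfolding integrally_closed_ideal_def by blast
qed

end

context presented_module
begin

lemma cofinite_entry:
  assumes "x \<in> m" obtains e c where "x ^ e = (\<Sum>i\<in>UNIV. c i * g i $ p)"
proof -
  obtain k where k: "\<forall>v. \<exists>c. x ^ k *s v = (\<Sum>i\<in>UNIV. c i *s g i)" using cofinite[OF assms] by (rule exE)
  obtain c where c: "x ^ k *s axis p 1 = (\<Sum>i\<in>UNIV. c i *s g i)" using spec[OF k, of "axis p 1"] by (rule exE)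
  have "x ^ k = (x ^ k *s axis p 1) $ p" by (simp add: axis_def)
  also have "\<dots> = (\<Sum>i\<in>UNIV. c i * g i $ p)" unfolding c by simp
  finally show thesis by (rule that)
qed

text \<open>
  For \<open>r = 1\<close> with generators \<open>y\<^sub>i, y\<^sub>j\<close> the Koszul relation \<open>(y\<^sub>j, - y\<^sub>i)\<close> is a multiple \<open>s \<Delta>\<close>. Then
  \<open>s\<close> divides all of \<open>N\<close>, which contains powers of a regular pair, so \<open>s\<close> is a unit and \<open>\<Delta>\<^sub>i\<close> is a
  unit multiple of \<open>y\<^sub>j\<close>.
\<close>

lemma parameters_if_not_socle_tight:
  assumes "\<not> socle_tight"
  obtains x t p where "x \<in> m" "\<And>z. z \<in> m \<Longrightarrow> \<exists>u v. z = u * x + v * t"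
    "UNIV = {p}" "\<exists>f\<in>N. t = f $ p"
proof -
  obtain p :: 'n where p: "UNIV = {p}"
    using rank_one_if_not_socle_tight[OF assms] by (rule card_1_singletonE)
  obtain f x w i where "f \<in> M" and x: "x \<in> m"
    and "x *s f = (\<Sum>j\<in>UNIV. w j *s g j)" "w i \<notin> m"
    and gen: "\<And>z. z \<in> m \<Longrightarrow> \<exists>u v. z = u * x + v * signed_minor g i"
    using assms by (rule not_socle_tight) (rule that)
  define j where "j = (case i of None \<Rightarrow> Some p | Some _ \<Rightarrow> None)"
  have q: "q = p" for q :: 'n using p by blast
  have opt: "l = None \<or> l = Some p" for l :: "'n option"
    using q[of "the l"] by (cases l) simp_all
  have ij: "l = i \<or> l = j" for l
    using opt[of l] opt[of i] by (auto simp: j_def)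
  have i_neq_j: "i \<noteq> j" by (cases i) (simp_all add: j_def)
  \<comment> \<open>The Koszul relation between the two generators.\<close>
  define k where "k l = (if l = i then g j $ p else - g i $ p)" for l
  have "(\<Sum>l\<in>UNIV. k l * g l $ q) = 0" for q
  proof -
    have U: "UNIV = {i, j}" using ij by auto
    show ?thesis unfolding q[of q] U using i_neq_j by (simp add: k_def mult.commute)
  qed
  then obtain s where s: "\<And>l. k l = s * signed_minor g l"
    by (rule relation_multiple) (rule that)
  have sdvd: "s dvd g l $ p" for l
  proof -
    have "s dvd k i" "s dvd k j" by (simp_all only: s dvd_triv_left)
    then have "s dvd g j $ p" "s dvd g i $ p" using i_neq_j by (simp_all add: k_def)
    then show ?thesis using ij[of l] by auto
  qed
  have pow: "\<exists>e. s dvd y ^ e" if y: "y \<in> m" for y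
  proof -
    obtain e c where e: "y ^ e = (\<Sum>i\<in>UNIV. c i * g i $ p)" using y by (rule cofinite_entry)
    have "s dvd y ^ e" unfolding e by (intro dvd_sum dvd_mult sdvd)
    then show ?thesis by (rule exI)
  qed
  have "s \<notin> m"
  proof
    assume sm: "s \<in> m"
    obtain e where e: "s dvd a ^ e" using pow[OF a_m] by (rule exE)
    obtain e' where e': "s dvd b ^ e'" using pow[OF b_m] by (rule exE)
    show False by (rule regular_pair_no_common_divisor_in_m[OF regular_pair_power[OF reg] sm e e'])
  qed
  then obtain u where u: "u * s = 1" by (rule unit_inverse)
  have "u * (g j $ p) = u * (s * signed_minor g i)"
    using s[of i] by (simp add: k_def)
  then have D: "signed_minor g i = u * (g j $ p)"
    by (simp only: mult.assoc[symmetric] u mult_1_left)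
  show thesis
  proof (rule that[OF x _ p])
    show "\<exists>f\<in>N. signed_minor g i = f $ p"
      unfolding D by (rule bexI[OF _ N_scale[OF g_N[of j], of u]]) simp
  qed (rule gen)
qed

lemma regular_and_closed_if_not_socle_tight:
  assumes "\<not> socle_tight"
  shows "CARD('n) = 1" "min_gens (*) m = 2" "integrally_closed_ideal {f $ i | f i. f \<in> N}"
proof -
  show "CARD('n) = 1" using assms by (rule rank_one_if_not_socle_tight)
  obtain x t p where x: "x \<in> m" and gen: "\<And>z. z \<in> m \<Longrightarrow> \<exists>u v. z = u * x + v * t"
    and p: "UNIV = {p}" and "\<exists>f\<in>N. t = f $ p"
    using assms by (rule parameters_if_not_socle_tight) (rule that)
  then obtain f where f: "f \<in> N" "t = f $ p" by (elim bexE)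
  have tm: "t \<in> m" unfolding f(2) using f(1) by (rule N_entries)
  let ?Q = "{f $ i | f i. f \<in> N}"
  have q: "q = p" for q :: 'n using p by blast
  have Q_I: "h $ p \<in> ?Q" if "h \<in> N" for h using that by blast
  have Q_E: "\<exists>h\<in>N. y = h $ p" if y: "y \<in> ?Q" for y
  proof -
    obtain h l where h: "y = h $ l" "h \<in> N" using y by blast
    show ?thesis by (rule bexI[OF _ h(2)]) (use h(1) q[of l] in simp)
  qed
  show "integrally_closed_ideal ?Q"
  proof -
    have sub: "module.subspace (*) ?Q"
      unfolding subspace_ring_iff
    proof (intro conjI ballI allI)
      show "0 \<in> ?Q" using Q_I[OF module.subspace_0[OF module_vec N_subspace]] by simp
      fix y assume "y \<in> ?Q"
      then obtain h where h: "h \<in> N" "y = h $ p" using Q_E by blast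
      show "c * y \<in> ?Q" for c using Q_I[OF N_scale[OF h(1), of c]] by (simp only: h vector_smult_component)
      fix z assume "z \<in> ?Q"
      then obtain h' where h': "h' \<in> N" "z = h' $ p" using Q_E by blast
      show "y + z \<in> ?Q" using Q_I[OF N_add[OF h(1) h'(1)]] by (simp only: h h' vector_add_component)
    qed
    obtain e c where e: "x ^ e = (\<Sum>i\<in>UNIV. c i * g i $ p)" using x by (rule cofinite_entry)
    have "x ^ e = (\<Sum>i\<in>UNIV. c i *s g i) $ p" unfolding e by simp
    then have xe: "x ^ e \<in> ?Q" using Q_I[OF N_I] by (rule ssubst)
    have tQ: "t \<in> ?Q" unfolding f(2) by (rule Q_I[OF f(1)])
    have nd: "\<not> t dvd x ^ e" for e
    proof
      assume te: "t dvd x ^ e"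
      have "t dvd y ^ e" if y: "y \<in> m" for y
      proof -
        obtain u v where uv: "y = u * x + v * t" using gen[OF y] by (elim exE)
        have "t dvd y ^ e - (u * x) ^ e" by (rule power_cong_dvd) (simp add: uv)
        moreover have "t dvd (u * x) ^ e" unfolding power_mult_distrib by (rule dvd_mult[OF te])
        ultimately have "t dvd (y ^ e - (u * x) ^ e) + (u * x) ^ e" by (rule dvd_add)
        then show ?thesis by simp
      qed
      from this[OF a_m] this[OF b_m] show False
        by (rule regular_pair_no_common_divisor_in_m[OF regular_pair_power[OF reg] tm])
    qed
    show ?thesis
      by (rule integrally_closed_ideal_if_contains_parameter[OF _ x nd sub tQ xe]) (rule gen)
  qed
  have "module.span (*) {x, t} = m"
  proof
    show "module.span (*) {x, t} \<subseteq> m"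
      using x tm by (intro module.span_minimal[OF module_ring] m_ideal) blast
    show "m \<subseteq> module.span (*) {x, t}" unfolding span_ring_pair using gen by blast
  qed
  then have "min_gens (*) m \<le> enat (card {x, t})"
    unfolding min_gens_def by (intro INF_lower) simp
  also have "\<dots> \<le> 2" by (cases "x = t") (simp_all add: numeral_eq_enat one_enat_def)
  finally have le: "min_gens (*) m \<le> 2" .
  have "2 \<le> enat (card G)" if G: "finite G" "module.span (*) G = m" for G
  proof (rule ccontr)
    assume "\<not> 2 \<le> enat (card G)"
    then have "card G \<le> Suc 0" by (simp add: numeral_eq_enat)
    then obtain y where y: "G \<subseteq> {y}" using G(1) card_le_Suc0_iff_eq[of G] by (cases "G = {}") blast+
    have "y dvd z" if "z \<in> m" for z
      using that module.span_mono[OF module_ring y] G(2) unfolding span_ring_singleton by blast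
    then have yd: "y dvd a" "y dvd b" using a_m b_m by blast+
    have "y \<in> m \<or> G = {}" using module.span_superset[OF module_ring, of G] G(2) y by blast
    then show False
    proof
      assume "y \<in> m"
      then show False using yd by (rule regular_pair_no_common_divisor_in_m[OF reg])
    next
      assume "G = {}"
      then have "m = {0}" using G(2) by (simp add: module.span_empty[OF module_ring])
      then have "0 dvd a" "0 dvd b" using a_m b_m by simp_all
      then show False by (rule regular_pair_no_common_divisor_in_m[OF reg m_0])
    qed
  qed
  then have "2 \<le> min_gens (*) m" unfolding min_gens_def by (intro INF_greatest) blast
  with le show "min_gens (*) m = 2" by (rule antisym)
qed

end

section \<open>Modules of finite colength\<close>

text \<open>
  The chain \<open>U k 0, \<dots>, U k k\<close> may depend on its length \<open>k\<close>, so that descending chains can be used as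
  well, after reversal.
\<close>

lemma finite_length_stationary:
  fixes N :: "('a::comm_ring_1 ^ 'n) set"
  assumes fin: "quotient_length (*s) UNIV N < \<infinity>"
    and U: "\<And>k i. i \<le> k \<Longrightarrow> module.subspace (*s) (U k i)" "\<And>k i. i \<le> k \<Longrightarrow> N \<subseteq> U k i"
  obtains k i where "i < k" "\<not> U k i \<subset> U k (Suc i)"
proof (rule ccontr)
  assume no: "\<not> thesis"
  note strict = that
  have step: "U k i \<subset> U k (Suc i)" if ik: "i < k" for k i
    using no strict[OF ik] by blast
  have le: "enat k \<le> quotient_length (*s) UNIV N" for k
    unfolding quotient_length_def
    by (rule SUP_upper, rule CollectI, rule exI[of _ "U k"]) (use U step in auto)
  obtain n where "quotient_length (*s) UNIV N = enat n" using fin by auto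
  with le[of "Suc n"] show False by simp
qed

text \<open>
  Otherwise one could adjoin new elements of \<open>M\<close> to the generators of \<open>N\<close> forever.
\<close>

lemma finitely_generated_over_finite_colength:
  fixes N M :: "('a::comm_ring_1 ^ 'n) set"
  assumes fin: "quotient_length (*s) UNIV N < \<infinity>"
    and N: "finite G" "module.span (*s) G = N"
    and M: "module.subspace (*s) M" "N \<subseteq> M"
  shows "\<exists>G'. finite G' \<and> module.span (*s) G' = M"
proof (rule ccontr)
  assume no: "\<nexists>G'. finite G' \<and> module.span (*s) G' = M"
  note span_le = module.span_minimal[OF module_vec _ M(1)]
  define new where "new H = (SOME y. y \<in> M - module.span (*s) H)" for H
  define H where "H k = ((\<lambda>H. insert (new H) H) ^^ k) G" for k
  have H_Suc: "H (Suc k) = insert (new (H k)) (H k)" for k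
    by (simp add: H_def)
  have new: "new K \<in> M - module.span (*s) K" if K: "finite K" "K \<subseteq> M" for K
  proof -
    have "module.span (*s) K \<subseteq> M" using K(2) by (rule span_le)
    moreover have "module.span (*s) K \<noteq> M" using no K(1) by blast
    ultimately have "\<exists>y. y \<in> M - module.span (*s) K" by blast
    then show ?thesis unfolding new_def by (rule someI_ex)
  qed
  have H: "finite (H k) \<and> H k \<subseteq> M" for k
  proof (induction k)
    case 0
    have "G \<subseteq> M" using module.span_superset[OF module_vec, of G] N(2) M(2) by blast
    then show ?case by (simp add: H_def N(1))
  next
    case (Suc k)
    then show ?case using new[of "H k"] by (simp add: H_Suc)
  qed
  obtain k i where "i < k" and i: "\<not> module.span (*s) (H i) \<subset> module.span (*s) (H (Suc i))"
  proof (rule finite_length_stationary[OF fin, of "\<lambda>k i. module.span (*s) (H i)"])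
    show "module.subspace (*s) (module.span (*s) (H i))" for i
      by (rule module.subspace_span[OF module_vec])
    have "G \<subseteq> H i" for i by (induction i) (auto simp: H_Suc, simp add: H_def)
    then show "N \<subseteq> module.span (*s) (H i)" for i
      unfolding N(2)[symmetric] by (rule module.span_mono[OF module_vec])
  qed (rule that)
  have "module.span (*s) (H i) \<subseteq> module.span (*s) (H (Suc i))"
    by (rule module.span_mono[OF module_vec]) (auto simp: H_Suc)
  moreover have "new (H i) \<in> module.span (*s) (H (Suc i))"
    by (rule module.span_base[OF module_vec]) (simp add: H_Suc)
  moreover have "new (H i) \<notin> module.span (*s) (H i)"
    using new[of "H i"] H[of i] by blast
  ultimately show False using i by blast
qed

text \<open>
  For a vector \<open>v\<close> the chain \<open>N + A x\<^sup>l v\<close> becomes stationary, so that \<open>(1 - c x) x\<^sup>l v \<in> N\<close> for some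
  \<open>c\<close>, and \<open>1 - c x\<close> is a unit.
\<close>

lemma (in local_ring) power_scale_mem_finite_colength:
  fixes N :: "('a ^ 'n::finite) set"
  assumes fin: "quotient_length (*s) UNIV N < \<infinity>" and N: "module.subspace (*s) N"
    and x: "x \<in> m"
  shows "\<exists>k. \<forall>v. x ^ k *s v \<in> N"
proof -
  have one: "\<exists>k. x ^ k *s v \<in> N" for v
  proof -
    \<comment> \<open>The exponent decreases with \<open>i\<close>, which makes the chain ascending.\<close>
    let ?U = "\<lambda>k i. module.span (*s) (insert (x ^ (k - i) *s v) N)"
    obtain k i where "i < k" and i: "\<not> ?U k i \<subset> ?U k (Suc i)"
    proof (rule finite_length_stationary[OF fin, of ?U])
      show "module.subspace (*s) (?U k i)" for k i
        by (rule module.subspace_span[OF module_vec])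
      show "N \<subseteq> ?U k i" for k i
        using module.span_superset[OF module_vec, of "insert (x ^ (k - i) *s v) N"] by blast
    qed (rule that)
    define l where "l = k - Suc i"
    have l: "k - i = Suc l" using \<open>i < k\<close> by (simp add: l_def)
    have "x *s (x ^ l *s v) \<in> module.span (*s) (insert (x ^ l *s v) N)"
      by (intro module.span_scale[OF module_vec] module.span_base[OF module_vec]) simp
    then have "insert (x ^ Suc l *s v) N \<subseteq> module.span (*s) (insert (x ^ l *s v) N)"
      using module.span_superset[OF module_vec, of "insert (x ^ l *s v) N"]
      by (simp add: vector_smult_assoc)
    then have "?U k i \<subseteq> ?U k (Suc i)"
      unfolding l l_def[symmetric]
      by (intro module.span_minimal[OF module_vec] module.subspace_span[OF module_vec])
    with i have "?U k (Suc i) \<subseteq> ?U k i" by blast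
    moreover have "x ^ l *s v \<in> ?U k (Suc i)"
      unfolding l_def by (intro module.span_base[OF module_vec]) simp
    ultimately have "x ^ l *s v \<in> module.span (*s) (insert (x ^ Suc l *s v) N)"
      unfolding l by blast
    then obtain c where "x ^ l *s v - c *s (x ^ Suc l *s v) \<in> N"
      unfolding module.span_insert[OF module_vec] module.span_eq_iff[OF module_vec, THEN iffD2, OF N]
      by blast
    moreover have "x ^ l *s v - c *s (x ^ Suc l *s v) = (1 - c * x) *s (x ^ l *s v)"
      by (simp add: vec_eq_iff algebra_simps)
    ultimately have mem: "(1 - c * x) *s (x ^ l *s v) \<in> N" by simp
    obtain u where u: "u * (1 - c * x) = 1"
      by (rule unit_inverse[OF one_minus_notin_m[OF m_mult[OF x]]])
    have "u *s ((1 - c * x) *s (x ^ l *s v)) \<in> N"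
      by (rule module.subspace_scale[OF module_vec N mem])
    moreover have "u *s ((1 - c * x) *s (x ^ l *s v)) = (u * (1 - c * x)) *s (x ^ l *s v)"
      by (simp only: vector_smult_assoc mult.assoc)
    ultimately have "x ^ l *s v \<in> N" by (simp only: u vector_smult_lid)
    then show ?thesis by (rule exI)
  qed
  then have "\<forall>p. \<exists>k. x ^ k *s axis p 1 \<in> N" by blast
  from choice[OF this] obtain K where K: "\<forall>p. x ^ K p *s axis p 1 \<in> N" by (rule exE)
  let ?k = "\<Sum>p\<in>UNIV. K p"
  have ax: "x ^ ?k *s axis p 1 \<in> N" for p
  proof -
    have "K p \<le> ?k" by (rule member_le_sum) simp_all
    then have "x ^ ?k *s axis p 1 = x ^ (?k - K p) *s (x ^ K p *s axis p 1)"
      by (simp add: vector_smult_assoc power_add[symmetric])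
    then show ?thesis using K by (simp only: module.subspace_scale[OF module_vec N])
  qed
  have "x ^ ?k *s v \<in> N" for v
  proof -
    have "x ^ ?k *s v = (\<Sum>p\<in>UNIV. v $ p *s (x ^ ?k *s axis p 1))"
      by (simp add: vec_eq_iff axis_def mult.commute if_distrib[of "\<lambda>z. _ * z"] cong: if_cong)
    then show ?thesis
      by (simp only:) (intro module.subspace_sum[OF module_vec N] module.subspace_scale[OF module_vec N] ax)
  qed
  then show ?thesis by blast
qed

section \<open>Integrality over the Rees algebra\<close>

lemma coeff_mult_top:
  fixes p q :: "'s::comm_ring_1 poly"
  assumes "\<And>i. i > d \<Longrightarrow> coeff p i = 0" "\<And>i. i > e \<Longrightarrow> coeff q i = 0" "l \<ge> d + e"
  shows "coeff (p * q) l = coeff p d * coeff q (l - d)"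
proof -
  have "coeff (p * q) l = (\<Sum>i\<in>{d}. coeff p i * coeff q (l - i))"
    unfolding coeff_mult
  proof (rule sum.mono_neutral_right)
    show "\<forall>i\<in>{..l} - {d}. coeff p i * coeff q (l - i) = 0"
    proof
      fix i assume i: "i \<in> {..l} - {d}"
      show "coeff p i * coeff q (l - i) = 0"
      proof (cases "i > d")
        case False
        then have "l - i > e" using i assms(3) by auto
        then show ?thesis by (simp add: assms(2))
      qed (simp add: assms(1))
    qed
  qed (use assms(3) in auto)
  then show ?thesis by simp
qed

text \<open>
  A determinant-free form of the Cayley-Hamilton trick. The matrices are polynomial with monic diagonal
  entries of degree \<open>d\<close> and off-diagonal entries of smaller degree. Eliminating the unknown \<open>x a\<close> by
  cross-multiplication with the row \<open>a\<close> preserves this shape with \<open>2 d\<close> in place of \<open>d\<close>, until only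
  the unknown \<open>x k\<close> is left.
\<close>

lemma monic_annihilator_by_elimination:
  fixes x :: "'i \<Rightarrow> 's::comm_ring_1"
  assumes R: "\<And>c d. c \<in> R \<Longrightarrow> d \<in> R \<Longrightarrow> c + d \<in> R" "\<And>c d. c \<in> R \<Longrightarrow> d \<in> R \<Longrightarrow> c * d \<in> R"
      "\<And>c. c \<in> R \<Longrightarrow> - c \<in> R" "0 \<in> R"
    and "finite A" "k \<notin> A"
    and "\<And>i j l. i \<in> insert k A \<Longrightarrow> j \<in> insert k A \<Longrightarrow> l \<ge> d \<Longrightarrow>
           coeff (P i j) l = (if i = j \<and> l = d then 1 else 0)"
    and "\<And>i j l. i \<in> insert k A \<Longrightarrow> j \<in> insert k A \<Longrightarrow> coeff (P i j) l \<in> R"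
    and "\<And>i. i \<in> insert k A \<Longrightarrow> (\<Sum>j\<in>insert k A. poly (P i j) s * x j) = 0"
  shows "\<exists>p e. coeff p e = 1 \<and> (\<forall>l>e. coeff p l = 0) \<and> (\<forall>l. coeff p l \<in> R) \<and> poly p s * x k = 0"
  using assms(5-)
proof (induction A arbitrary: P d rule: finite_induct)
  case empty
  then show ?case by (intro exI[of _ "P k k"] exI[of _ d]) auto
next
  case (insert a A)
  note top = insert.prems(2) and cf = insert.prems(3) and eq = insert.prems(4)
  have a: "a \<noteq> k" "a \<notin> insert k A" using insert.prems(1) insert.hyps by auto
  have R_sum: "(\<Sum>i\<in>I. f i) \<in> R" if "\<And>i. f i \<in> R" for I :: "nat set" and f
    using that by (induction I rule: infinite_finite_induct) (auto intro: R)
  have R_mult: "coeff (p * q) l \<in> R" if "\<And>l. coeff p l \<in> R" "\<And>l. coeff q l \<in> R" for p q l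
    unfolding coeff_mult by (intro R_sum R that)
  \<comment> \<open>The two products of off-diagonal entries have degree below \<open>2 d\<close> and do not disturb the shape.\<close>
  define P' where "P' i j = P a a * P i j - P i a * P a j" for i j
  have mem: "i \<in> insert k (insert a A)" if "i \<in> insert k A" for i using that by blast
  have am: "a \<in> insert k (insert a A)" by blast
  show ?case
  proof (rule insert.IH[of "d + d" P'])
    show "k \<notin> A" using insert.prems(1) by blast
    fix i assume i: "i \<in> insert k A"
    have ia: "i \<noteq> a" using i a by blast
    show "(\<Sum>j\<in>insert k A. poly (P' i j) s * x j) = 0"
    proof -
      have split: "(\<Sum>j\<in>insert k A. poly (P i' j) s * x j) = - (poly (P i' a) s * x a)"
        if "i' \<in> insert k (insert a A)" for i'
      proof -
        have "(\<Sum>j\<in>insert k (insert a A). poly (P i' j) s * x j)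
            = poly (P i' a) s * x a + (\<Sum>j\<in>insert k A. poly (P i' j) s * x j)"
          unfolding insert_commute[of k a] using insert.hyps a(2) by (intro sum.insert) simp_all
        with eq[OF that] show ?thesis by (simp add: eq_neg_iff_add_eq_0 add.commute)
      qed
      have "(\<Sum>j\<in>insert k A. poly (P' i j) s * x j) =
          poly (P a a) s * (\<Sum>j\<in>insert k A. poly (P i j) s * x j)
          - poly (P i a) s * (\<Sum>j\<in>insert k A. poly (P a j) s * x j)"
        unfolding sum_distrib_left sum_subtractf[symmetric] P'_def
        by (intro sum.cong refl) (simp add: left_diff_distrib mult.assoc)
      also have "\<dots> = 0" unfolding split[OF mem[OF i]] split[OF am] by (simp add: mult.left_commute)
      finally show ?thesis .
    qed
    fix j l assume j: "j \<in> insert k A"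
    have ja: "j \<noteq> a" using j a by blast
    have diff_R: "c - d \<in> R" if "c \<in> R" "d \<in> R" for c d
      using R(1)[OF that(1) R(3)[OF that(2)]] by simp
    show "coeff (P' i j) l \<in> R"
      unfolding P'_def coeff_diff by (intro diff_R R_mult cf mem i j am)
    assume l: "d + d \<le> l"
    have z: "coeff (P i' j') l' = 0" if "i' \<in> insert k (insert a A)" "j' \<in> insert k (insert a A)" "l' > d" for i' j' l'
      using top[OF that(1,2), of l'] that(3) by simp
    have "coeff (P a a * P i j) l = coeff (P a a) d * coeff (P i j) (l - d)"
      by (rule coeff_mult_top[of d _ d]) (use z am mem i j l in simp_all)
    moreover have "coeff (P i a * P a j) l = coeff (P i a) d * coeff (P a j) (l - d)"
      by (rule coeff_mult_top[of d _ d]) (use z am mem i j l in simp_all)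
    ultimately show "coeff (P' i j) l = (if i = j \<and> l = d + d then 1 else 0)"
      using top[OF am am, of d] top[OF mem[OF i] mem[OF j], of "l - d"] top[OF mem[OF i] am, of d] l ia
      by (auto simp: P'_def)
  qed
qed

lemma rees_minus: "p \<in> rees_algebra N \<Longrightarrow> - p \<in> rees_algebra N"
proof -
  assume p: "p \<in> rees_algebra N"
  have "sym_const (- 1) * p \<in> rees_algebra N"
    by (rule rees_algebra.mult[OF rees_algebra.const p])
  moreover have "sym_const (- 1) * p = - p"
    using module.scale_minus_left[OF module_sym, of 1 p] module.scale_one[OF module_sym, of p]
    by (simp add: sym_scale_def)
  ultimately show ?thesis by simp
qed

lemma rees_0: "0 \<in> rees_algebra N"
  using rees_algebra.const[of 0 N] by (simp add: sym_const_def)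

lemma rees_1: "1 \<in> rees_algebra N"
  using rees_algebra.const[of 1 N] by (simp add: sym_const_def)

lemma submodule_prod_span_elem:
  assumes N: "module.subspace (*s) N" and B: "finite B"
    and z: "z \<in> submodule_prod N (module.span (*s) B)"
  obtains w where "\<And>l. w l \<in> N" "z = (\<Sum>l\<in>B. sym_lin (w l) * sym_lin l)"
proof -
  let ?T = "{\<Sum>l\<in>B. sym_lin (w l) * sym_lin l | w. \<forall>l. w l \<in> N}"
  have N0: "0 \<in> N" and Na: "\<And>x y. x \<in> N \<Longrightarrow> y \<in> N \<Longrightarrow> x + y \<in> N"
    and Ns: "\<And>c x. x \<in> N \<Longrightarrow> c *s x \<in> N"
    using N unfolding subspace_vec_iff by blast+
  have T_I: "(\<Sum>l\<in>B. sym_lin (w l) * sym_lin l) \<in> ?T" if "\<forall>l. w l \<in> N" for w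
    using that by blast
  have sub: "module.subspace sym_scale ?T"
    unfolding module.subspace_def[OF module_sym]
  proof (intro conjI ballI allI)
    show "0 \<in> ?T" using T_I[of "\<lambda>_. 0"] N0 by simp
    fix y assume "y \<in> ?T"
    then obtain v where v: "y = (\<Sum>l\<in>B. sym_lin (v l) * sym_lin l)" "\<forall>l. v l \<in> N" by blast
    show "sym_scale c y \<in> ?T" for c
      using T_I[of "\<lambda>l. c *s v l"] v(2) Ns
      by (simp add: v(1) sym_scale_def sum_distrib_left sym_lin_scale mult.assoc)
    fix y' assume "y' \<in> ?T"
    then obtain v' where v': "y' = (\<Sum>l\<in>B. sym_lin (v' l) * sym_lin l)" "\<forall>l. v' l \<in> N" by blast
    show "y + y' \<in> ?T"
      using T_I[of "\<lambda>l. v l + v' l"] v(2) v'(2) Na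
      by (simp add: v(1) v'(1) sum.distrib sym_lin_add distrib_right)
  qed
  have "sym_lin x * sym_lin y \<in> ?T" if x: "x \<in> N" and y: "y \<in> module.span (*s) B" for x y
  proof -
    obtain c where y: "y = (\<Sum>l\<in>B. c l *s l)"
      using y unfolding module.span_finite[OF module_vec B] by blast
    have "sym_lin x * sym_lin y = (\<Sum>l\<in>B. sym_lin (c l *s x) * sym_lin l)"
      unfolding y sym_lin_sum sym_lin_scale sum_distrib_left by (intro sum.cong refl) (simp only: mult_ac)
    then show ?thesis using T_I[of "\<lambda>l. c l *s x"] Ns[OF x] by simp
  qed
  then have "submodule_prod N (module.span (*s) B) \<subseteq> ?T"
    unfolding submodule_prod_def by (intro module.span_minimal[OF module_sym] sub) blast
  with z have "z \<in> ?T" by blast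
  then show thesis using that by blast
qed

text \<open>
  Elimination yields a monic polynomial in \<open>f\<close> that kills one chosen generator of \<open>M\<close>. Choosing
  \<open>axis p c\<close>, whose image in the polynomial ring is a nonzerodivisor, makes the polynomial vanish at
  \<open>f\<close>.
\<close>

lemma integral_if_stabilizes_module:
  fixes N :: "('a::comm_ring_1 ^ 'n::finite) set"
  assumes N: "module.subspace (*s) N" and B: "finite B" "module.span (*s) B = M"
    and stab: "\<And>y. y \<in> M \<Longrightarrow> sym_lin f * sym_lin y \<in> submodule_prod N M"
    and c: "\<And>y. c * y = 0 \<Longrightarrow> y = 0" "axis p c \<in> M"
    and nontriv: "(1::'a) \<noteq> 0"
  shows "f \<in> module_integral_closure N"
proof -
  \<comment> \<open>The distinguished generator that survives the elimination.\<close>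
  define k where "k = axis p c"
  define A where "A = B - {k}"
  define C where "C = insert k A"
  have C: "finite C" "finite A" "k \<notin> A" unfolding C_def A_def using B(1) by simp_all
  have CB: "C = insert k B" unfolding C_def A_def by blast
  have k_M: "k \<in> M" unfolding k_def by (rule c(2))
  have "module.subspace (*s) M"
    unfolding B(2)[symmetric] by (rule module.subspace_span[OF module_vec])
  moreover have "C \<subseteq> M"
    unfolding CB using k_M module.span_superset[OF module_vec, of B] B(2) by simp
  moreover have "M \<subseteq> module.span (*s) C"
    unfolding B(2)[symmetric] CB by (rule module.span_mono[OF module_vec]) blast
  ultimately have span_C: "module.span (*s) C = M"
    using module.span_minimal[OF module_vec, of C M] by blast
  have "\<exists>w. (\<forall>l. w l \<in> N) \<and> (i \<in> C \<longrightarrow> sym_lin f * sym_lin i = (\<Sum>l\<in>C. sym_lin (w l) * sym_lin l))" for i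
  proof (cases "i \<in> C")
    case True
    then have "i \<in> M" using module.span_base[OF module_vec, of i C] span_C by simp
    then have "sym_lin f * sym_lin i \<in> submodule_prod N (module.span (*s) C)"
      unfolding span_C by (rule stab)
    then obtain w where "\<And>l. w l \<in> N" "sym_lin f * sym_lin i = (\<Sum>l\<in>C. sym_lin (w l) * sym_lin l)"
      by (rule submodule_prod_span_elem[OF N C(1)]) (rule that)
    then show ?thesis by (intro exI[of _ w]) simp
  next
    case False
    then show ?thesis using N unfolding subspace_vec_iff by (intro exI[of _ "\<lambda>_. 0"]) simp
  qed
  then have "\<forall>i. \<exists>w. (\<forall>l. w l \<in> N) \<and> (i \<in> C \<longrightarrow> sym_lin f * sym_lin i = (\<Sum>l\<in>C. sym_lin (w l) * sym_lin l))" ..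
  from choice[OF this] obtain w where w: "\<forall>i. (\<forall>l. w i l \<in> N) \<and>
    (i \<in> C \<longrightarrow> sym_lin f * sym_lin i = (\<Sum>l\<in>C. sym_lin (w i l) * sym_lin l))" by (rule exE)
  let ?R = "rees_algebra N"
  define P where "P i j = (if i = j then [:- sym_lin (w i j), 1:] else [:- sym_lin (w i j):])" for i j
  have wR: "- sym_lin (w i j) \<in> ?R" for i j
    using w by (intro rees_minus rees_algebra.lin) blast
  have "\<exists>q e. coeff q e = 1 \<and> (\<forall>l>e. coeff q l = 0) \<and> (\<forall>l. coeff q l \<in> ?R) \<and> poly q (sym_lin f) * sym_lin k = 0"
  proof (rule monic_annihilator_by_elimination[where A = A and P = P and d = 1])
    show "coeff (P i j) l = (if i = j \<and> l = 1 then 1 else 0)" if "l \<ge> 1" for i j l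
      using that by (cases l) (auto simp: P_def coeff_pCons split: nat.split)
    show "coeff (P i j) l \<in> ?R" for i j l
      using wR[of i j] rees_0[of N] rees_1[of N] by (auto simp: P_def coeff_pCons split: nat.split)
    fix i assume "i \<in> insert k A"
    then have i: "i \<in> C" by (simp add: C_def)
    have "(\<Sum>j\<in>C. poly (P i j) (sym_lin f) * sym_lin j) =
        (\<Sum>j\<in>C. (if j = i then sym_lin f * sym_lin i else 0) - sym_lin (w i j) * sym_lin j)"
      by (intro sum.cong refl) (auto simp: P_def left_diff_distrib)
    also have "\<dots> = sym_lin f * sym_lin i - (\<Sum>j\<in>C. sym_lin (w i j) * sym_lin j)"
      using i C(1) by (simp add: sum_subtractf)
    also have "\<dots> = 0" using w i by simp
    finally show "(\<Sum>j\<in>insert k A. poly (P i j) (sym_lin f) * sym_lin j) = 0" by (simp only: C_def)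
  qed (use C(2,3) in \<open>auto intro: rees_algebra.intros rees_minus rees_0\<close>)
  then obtain q e where q: "coeff q e = 1" "\<And>l. l > e \<Longrightarrow> coeff q l = 0" "\<And>l. coeff q l \<in> ?R"
    and z: "poly q (sym_lin f) * sym_lin k = 0" by blast
  have "poly q (sym_lin f) = 0"
    by (rule sym_monomial_mult_eq_0[OF _ z[unfolded k_def sym_lin_axis]]) (rule c(1))
  moreover have "degree q = e"
  proof (rule antisym)
    show "degree q \<le> e" using q(2) by (intro degree_le) blast
    have "coeff q e \<noteq> 0" unfolding q(1) using nontriv
      by (metis lookup_one_zero lookup_zero)
    then show "e \<le> degree q" by (rule le_degree)
  qed
  ultimately have "lead_coeff q = 1 \<and> (\<forall>i. coeff q i \<in> ?R) \<and> poly q (sym_lin f) = 0"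
    using q(1,3) by simp
  then show ?thesis
    unfolding module_integral_closure_def integral_over_subring_def by blast
qed

lemma subset_module_integral_closure: "N \<subseteq> module_integral_closure N"
proof
  fix f assume f: "f \<in> N"
  let ?p = "[:- sym_lin f, 1:]"
  have "coeff ?p i \<in> rees_algebra N" for i
    using rees_minus[OF rees_algebra.lin[OF f]] rees_0[of N] rees_1[of N]
    by (auto simp: coeff_pCons split: nat.split)
  moreover have "lead_coeff ?p = 1" "poly ?p (sym_lin f) = 0" by simp_all
  ultimately show "f \<in> module_integral_closure N"
    unfolding module_integral_closure_def integral_over_subring_def by blast
qed

lemma ideal_power_mult:
  fixes Q :: "'a::comm_ring_1 set"
  assumes "y \<in> ideal_power Q i" "z \<in> ideal_power Q j"
  shows "y * z \<in> ideal_power Q (i + j)"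
  using assms(1)
proof (induction i arbitrary: y)
  case 0
  have sub: "module.subspace (*) (ideal_power Q j)"
    by (cases j) (simp_all add: module.subspace_span[OF module_ring] module.subspace_UNIV[OF module_ring])
  show ?case using module.subspace_scale[OF module_ring sub assms(2)] by simp
next
  case (Suc i)
  have sub: "module.subspace (*) {y. y * z \<in> ideal_power Q (Suc i + j)}"
    unfolding subspace_ring_iff
    by (auto simp: distrib_right mult.assoc module.span_zero[OF module_ring]
        intro!: module.span_add[OF module_ring] module.span_scale[OF module_ring])
  have "u * v * z \<in> ideal_power Q (Suc i + j)" if "u \<in> Q" "v \<in> ideal_power Q i" for u v
    using that Suc.IH[OF that(2)]
    by (auto simp: mult.assoc intro!: module.span_base[OF module_ring])
  then have "module.span (*) {u * v | u v. u \<in> Q \<and> v \<in> ideal_power Q i} \<subseteq> {y. y * z \<in> ideal_power Q (Suc i + j)}"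
    by (intro module.span_minimal[OF module_ring] sub) blast
  with Suc.prems show ?case by auto
qed

lemma subspace_ideal_power: "module.subspace (*) (ideal_power Q j)"
  by (cases j) (simp_all add: module.subspace_span[OF module_ring] module.subspace_UNIV[OF module_ring])

text \<open>
  The component of degree \<open>k\<close> of the Rees algebra of an ideal is the \<open>k\<close>-th power of the ideal.
\<close>

lemma lookup_rees_algebra_rank_one:
  fixes N :: "('a::comm_ring_1 ^ 'n::finite) set"
  assumes rank: "(UNIV :: 'n set) = {p}" and z: "z \<in> rees_algebra N"
  shows "Poly_Mapping.lookup z (Poly_Mapping.single p k) \<in> ideal_power {f $ i | f i. f \<in> N} k"
  using z
proof (induction arbitrary: k rule: rees_algebra.induct)
  case (const c)
  show ?case
  proof (cases k)
    case (Suc i)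
    then have "Poly_Mapping.lookup (Poly_Mapping.single p k) p \<noteq> Poly_Mapping.lookup 0 p" by simp
    then have "0 \<noteq> Poly_Mapping.single p k" by metis
    then show ?thesis
      by (simp add: sym_const_def lookup_single when_def
          module.subspace_0[OF module_ring subspace_ideal_power])
  qed simp
next
  case (lin f)
  have "sym_lin f = Poly_Mapping.single (Poly_Mapping.single p 1) (f $ p)"
    unfolding sym_lin_def rank by simp
  moreover have "f $ p \<in> ideal_power {f $ i | f i. f \<in> N} 1"
  proof -
    have "f $ p * 1 \<in> module.span (*) {x * y | x y. x \<in> {f $ i | f i. f \<in> N} \<and> y \<in> UNIV}"
      using lin by (intro module.span_base[OF module_ring]) blast
    then show ?thesis by simp
  qed
  moreover have "Poly_Mapping.single p 1 \<noteq> Poly_Mapping.single p k" if "k \<noteq> 1"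
    using that by (metis lookup_single_eq)
  ultimately show ?case
    by (cases "k = 1")
      (simp_all add: lookup_single when_def module.subspace_0[OF module_ring subspace_ideal_power]
        del: One_nat_def)
next
  case (add y z)
  then show ?case
    by (simp add: lookup_add module.subspace_add[OF module_ring subspace_ideal_power])
next
  case (mult y z)
  have exps: "\<exists>i. u = Poly_Mapping.single p i" for u :: "'n \<Rightarrow>\<^sub>0 nat"
  proof (intro exI poly_mapping_eqI)
    fix q have "q = p" using rank by blast
    then show "Poly_Mapping.lookup u q = Poly_Mapping.lookup (Poly_Mapping.single p (Poly_Mapping.lookup u p)) q"
      by simp
  qed
  have y: "y = (\<Sum>u\<in>Poly_Mapping.keys y. Poly_Mapping.single u (Poly_Mapping.lookup y u))"
    by (rule poly_mapping_eqI) (simp add: lookup_sum lookup_single when_def in_keys_iff)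
  have "Poly_Mapping.lookup (Poly_Mapping.single u (Poly_Mapping.lookup y u) * z) (Poly_Mapping.single p k)
      \<in> ideal_power {f $ i | f i. f \<in> N} k" for u
  proof -
    obtain i where u: "u = Poly_Mapping.single p i" using exps by blast
    show ?thesis
    proof (cases "i \<le> k")
      case True
      have k: "Poly_Mapping.single p k = u + Poly_Mapping.single p (k - i)"
        using True by (simp add: u single_add[symmetric])
      have "Poly_Mapping.lookup (Poly_Mapping.single u (Poly_Mapping.lookup y u) * z) (Poly_Mapping.single p k)
          = Poly_Mapping.lookup y u * Poly_Mapping.lookup z (Poly_Mapping.single p (k - i))"
        unfolding k by (simp add: lookup_mult lookup_single when_mult)
      then show ?thesis
        using ideal_power_mult[OF mult.IH(1)[of i] mult.IH(2)[of "k - i"]] True by (simp add: u)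
    next
      case False
      have "Poly_Mapping.single p k \<noteq> u + v" for v
      proof
        assume "Poly_Mapping.single p k = u + v"
        then have "Poly_Mapping.lookup (Poly_Mapping.single p k) p = Poly_Mapping.lookup (u + v) p" by simp
        then show False using False by (simp add: u lookup_add)
      qed
      then have "Poly_Mapping.lookup (Poly_Mapping.single u (Poly_Mapping.lookup y u) * z) (Poly_Mapping.single p k) = 0"
        by (simp add: lookup_mult lookup_single when_mult)
      then show ?thesis using module.subspace_0[OF module_ring subspace_ideal_power] by simp
    qed
  qed
  then show ?case
    by (subst y) (simp only: sum_distrib_right lookup_sum module.subspace_sum[OF module_ring subspace_ideal_power])
qed

text \<open>
  For a monic polynomial of degree \<open>d\<close>, the homogeneous component of degree \<open>d\<close> of the equation for
  \<open>f\<close> is an integral equation over the ideal.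
\<close>

lemma integral_equation_rank_one:
  fixes N :: "('a::comm_ring_1 ^ 'n::finite) set"
  assumes rank: "(UNIV :: 'n set) = {p}" and f: "f \<in> module_integral_closure N"
    and nontriv: "(1::'a) \<noteq> 0"
  shows "f $ p \<in> ideal_integral_closure {f $ i | f i. f \<in> N}"
proof -
  let ?Q = "{f $ i | f i. f \<in> N}"
  obtain P where P: "lead_coeff P = 1" "\<And>i. coeff P i \<in> rees_algebra N" "poly P (sym_lin f) = 0"
    using f unfolding module_integral_closure_def integral_over_subring_def by blast
  define d where "d = degree P"
  define c where "c i = Poly_Mapping.lookup (coeff P (d - i)) (Poly_Mapping.single p i)" for i
  have S: "sym_lin f ^ i = Poly_Mapping.single (Poly_Mapping.single p i) ((f $ p) ^ i)" for i
  proof (induction i)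
    case (Suc i)
    have "sym_lin f = Poly_Mapping.single (Poly_Mapping.single p 1) (f $ p)"
      unfolding sym_lin_def rank by simp
    then show ?case
      unfolding power_Suc Suc.IH by (simp only: mult_single single_add[symmetric] plus_1_eq_Suc)
  qed simp
  have term_eq: "Poly_Mapping.lookup (coeff P i * sym_lin f ^ i) (Poly_Mapping.single p d) = c (d - i) * (f $ p) ^ i"
    if i: "i \<le> d" for i
  proof -
    have "Poly_Mapping.lookup (Poly_Mapping.single (Poly_Mapping.single p i) ((f $ p) ^ i) * coeff P i)
        (Poly_Mapping.single p i + Poly_Mapping.single p (d - i))
        = (f $ p) ^ i * Poly_Mapping.lookup (coeff P i) (Poly_Mapping.single p (d - i))"
      by (simp add: lookup_mult lookup_single when_mult)
    moreover have "Poly_Mapping.single p i + Poly_Mapping.single p (d - i) = Poly_Mapping.single p d"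
      using i by (simp add: single_add[symmetric])
    ultimately show ?thesis using i by (simp add: S c_def mult.commute)
  qed
  have "Poly_Mapping.lookup (\<Sum>i\<le>d. coeff P i * sym_lin f ^ i) (Poly_Mapping.single p d) = 0"
    using P(3) unfolding poly_altdef d_def[symmetric] by simp
  then have "(\<Sum>i\<le>d. c (d - i) * (f $ p) ^ i) = 0"
    unfolding lookup_sum by (simp add: term_eq)
  also have "(\<Sum>i\<le>d. c (d - i) * (f $ p) ^ i) = (\<Sum>i\<le>d. c i * (f $ p) ^ (d - i))"
    by (rule sum.reindex_bij_witness[of _ "\<lambda>i. d - i" "\<lambda>i. d - i"]) auto
  also have "\<dots> = c 0 * (f $ p) ^ d + (\<Sum>i=1..d. c i * (f $ p) ^ (d - i))"
  proof -
    have "{..d} = insert 0 {1..d}" by auto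
    then show ?thesis by simp
  qed
  also have "c 0 = 1" using P(1) by (simp add: c_def d_def)
  finally have eq: "(f $ p) ^ d + (\<Sum>i=1..d. c i * (f $ p) ^ (d - i)) = 0" by simp
  have "d > 0"
  proof (rule ccontr)
    assume "\<not> d > 0"
    with eq nontriv show False by simp
  qed
  moreover have "c i \<in> ideal_power ?Q i" for i
    unfolding c_def by (rule lookup_rees_algebra_rank_one[OF rank P(2)])
  ultimately show ?thesis
    unfolding ideal_integral_closure_def using eq by blast
qed

section \<open>The dichotomy and the three conditions\<close>

context presented_module
begin

lemma one_neq_zero: "(1::'a) \<noteq> 0"
  using one_notin_m m_0 by metis

lemma M_subspace: "module.subspace (*s) M"
  unfolding subspace_vec_iff module_colon_def
  using N_add N_scale module.subspace_0[OF module_vec N_subspace]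
  by (auto simp: vector_add_ldistrib) (metis N_scale vector_smult_assoc mult.commute)

text \<open>
  Since \<open>N \<noteq> F\<close>, one finds an element of the socle of \<open>F/N\<close> by multiplying a vector outside \<open>N\<close> with
  maximal powers of the generators of \<open>m\<close>, one generator after the other.
\<close>

lemma M_neq_N: "M \<noteq> N"
proof -
  obtain G where G: "finite G" "module.span (*) G = m"
    using noeth_local m_ideal unfolding noetherian_local_ring_def by blast
  have Gm: "G \<subseteq> m" using G(2) module.span_superset[OF module_ring, of G] by blast
  have "\<exists>f. f \<notin> N \<and> (\<forall>x\<in>H. x *s f \<in> N)" if "finite H" "H \<subseteq> m" for H
    using that
  proof (induction H rule: finite_induct)
    case empty
    have "axis p 1 \<notin> N" for p
      using N_entries[of "axis p 1" p] one_notin_m by (auto simp: axis_def)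
    then show ?case by blast
  next
    case (insert x H)
    then obtain f where f: "f \<notin> N" "\<forall>y\<in>H. y *s f \<in> N" by blast
    obtain k where k: "\<forall>v. \<exists>c. x ^ k *s v = (\<Sum>i\<in>UNIV. c i *s g i)"
      using cofinite[of x] insert.prems by blast
    have "x ^ k *s f \<in> N" using spec[OF k, of f] unfolding N_def by simp
    define n where "n = (LEAST k. x ^ k *s f \<in> N)"
    have n: "x ^ n *s f \<in> N" unfolding n_def using \<open>x ^ k *s f \<in> N\<close> by (rule LeastI)
    have "n \<noteq> 0" using n f(1) by (cases n) simp_all
    then obtain l where l: "n = Suc l" by (cases n) simp_all
    have "x ^ l *s f \<notin> N"
      using not_less_Least[of l "\<lambda>k. x ^ k *s f \<in> N"] l unfolding n_def by simp
    moreover have "x *s (x ^ l *s f) \<in> N" using n unfolding l by (simp add: vector_smult_assoc)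
    moreover have "y *s (x ^ l *s f) \<in> N" if "y \<in> H" for y
      using N_scale[OF bspec[OF f(2) that], of "x ^ l"] by (simp add: vector_smult_assoc mult.commute)
    ultimately show ?case by blast
  qed
  from this[OF G(1) Gm] obtain f where f: "f \<notin> N" "\<forall>x\<in>G. x *s f \<in> N" by blast
  have "module.subspace (*) {x. x *s f \<in> N}"
    unfolding subspace_ring_iff
    using N_add N_scale module.subspace_0[OF module_vec N_subspace]
    by (auto simp: vector_sadd_rdistrib vector_smult_assoc[symmetric])
  then have "module.span (*) G \<subseteq> {x. x *s f \<in> N}"
    using f(2) by (intro module.span_minimal[OF module_ring]) blast
  then have "f \<in> M" unfolding module_colon_def G(2) by blast
  with f(1) show ?thesis by blast
qed

text \<open>
  By \<open>M\<^sup>2 = N M\<close> multiplication by an element of \<open>M\<close> stabilizes \<open>M\<close> up to coefficients in \<open>N\<close>, so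
  \<open>M\<close> is integral over \<open>N\<close>; but it is strictly larger.
\<close>

lemma not_integrally_closed_if_square_eq:
  assumes fin: "quotient_length (*s) UNIV N < \<infinity>"
    and sq: "submodule_prod M M = submodule_prod N M"
  shows "\<not> integrally_closed_module N"
proof
  assume closed: "integrally_closed_module N"
  have N_fg: "module.span (*s) (range g) = N"
  proof
    show "module.span (*s) (range g) \<subseteq> N"
      by (intro module.span_minimal[OF module_vec] N_subspace) (use g_N in blast)
    show "N \<subseteq> module.span (*s) (range g)"
    proof
      fix f assume "f \<in> N"
      then obtain c where "f = (\<Sum>i\<in>UNIV. c i *s g i)" by (rule N_E)
      then show "f \<in> module.span (*s) (range g)"
        by (simp only:) (intro module.span_sum[OF module_vec] module.span_scale[OF module_vec]
          module.span_base[OF module_vec] rangeI)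
    qed
  qed
  obtain B where B: "finite B" "module.span (*s) B = M"
    using finitely_generated_over_finite_colength[OF fin _ N_fg M_subspace N_subset_M] by auto
  obtain k where k: "\<forall>v. \<exists>c. a ^ k *s v = (\<Sum>i\<in>UNIV. c i *s g i)" using cofinite[OF a_m] by (rule exE)
  fix p :: 'n
  have "a ^ k *s axis p 1 \<in> N" using spec[OF k, of "axis p 1"] unfolding N_def by simp
  moreover have "a ^ k *s axis p 1 = axis p (a ^ k)" by (simp add: vec_eq_iff axis_def)
  ultimately have kM: "axis p (a ^ k) \<in> M" using N_subset_M by auto
  have "M \<subseteq> module_integral_closure N"
  proof
    fix f assume f: "f \<in> M"
    show "f \<in> module_integral_closure N"
    proof (rule integral_if_stabilizes_module[OF N_subspace B _ _ kM one_neq_zero])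
      show "sym_lin f * sym_lin y \<in> submodule_prod N M" if "y \<in> M" for y
        unfolding sq[symmetric] using f that by (rule submodule_prod_base)
      show "y = 0" if "a ^ k * y = 0" for y
        using regular_pairD1[OF regular_pair_power_left[OF reg] that] .
    qed
  qed
  then have "M \<subseteq> N" using closed unfolding integrally_closed_module_def by simp
  with N_subset_M M_neq_N show False by blast
qed

lemma integrally_closed_if_rank_one:
  assumes card: "CARD('n) = 1" and closed: "integrally_closed_ideal {f $ i | f i. f \<in> N}"
  shows "integrally_closed_module N"
proof -
  obtain p :: 'n where p: "UNIV = {p}" using card by (rule card_1_singletonE)
  have "f \<in> N" if f: "f \<in> module_integral_closure N" for f
  proof -
    have "f $ p \<in> {f $ i | f i. f \<in> N}"
      using integral_equation_rank_one[OF p f one_neq_zero] closed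
      unfolding integrally_closed_ideal_def by simp
    then obtain h i where h: "f $ p = h $ i" "h \<in> N" by blast
    have q: "q = p" for q :: 'n using p by blast
    have "f $ q = h $ q" for q
      unfolding q[of q] using h(1) unfolding q[of i] .
    then have "f = h" by (simp add: vec_eq_iff)
    then show ?thesis using h(2) by simp
  qed
  then show ?thesis
    unfolding integrally_closed_module_def using subset_module_integral_closure by blast
qed

end

lemma min_gens_attained:
  assumes "min_gens act N = enat k"
  obtains G where "finite G" "module.span act G = N" "card G = k"
proof -
  let ?S = "(\<lambda>G. enat (card G)) ` {G. finite G \<and> module.span act G = N}"
  have "?S \<noteq> {}"
  proof
    assume "?S = {}"
    then have "min_gens act N = \<infinity>" unfolding min_gens_def by (simp only: Inf_empty top_enat_def)
    with assms show False by simp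
  qed
  then obtain z where "z \<in> ?S" by blast
  then have "Inf ?S \<in> ?S" by (rule wellorder_InfI)
  then have "enat k \<in> ?S" using assms unfolding min_gens_def by simp
  then show thesis using that by auto
qed

lemma ideal_times_free_entries:
  fixes f :: "'a::comm_ring_1 ^ 'n"
  assumes m: "module.subspace (*) m" and f: "f \<in> ideal_times_free m"
  shows "f $ p \<in> m"
proof -
  have "module.subspace (*s) {f. f $ p \<in> m}"
    using m unfolding subspace_vec_iff subspace_ring_iff by simp
  moreover have "c * (f $ p) \<in> m" if "c \<in> m" for c and f :: "'a ^ 'n"
    using module.subspace_scale[OF module_ring m that, of "f $ p"] by (simp add: mult.commute)
  then have "{c *s f | c f. c \<in> m} \<subseteq> {f. f $ p \<in> m}" by auto
  ultimately have "ideal_times_free m \<subseteq> {f. f $ p \<in> m}"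
    unfolding ideal_times_free_def by (intro module.span_minimal[OF module_vec])
  with f show ?thesis by blast
qed

theorem theorem5p1:
  fixes m :: "'a::comm_ring_1 set"
    and N M :: "('a ^ 'n::finite) set"
  assumes "cohen_macaulay_local_ring m"
    and "krull_dimension TYPE('a) = 2"
    and "parameter_module N"
    and "N \<subseteq> ideal_times_free m"
    and "M = module_colon N m"
  shows "(submodule_prod M M \<noteq> submodule_prod N M \<longleftrightarrow> integrally_closed_module N) \<and>
         (integrally_closed_module N \<longleftrightarrow>
            regular_local_ring m \<and> CARD('n) = 1 \<and>
            integrally_closed_ideal {x $ i | x i. x \<in> N})"
proof -
  interpret local_ring m
    using assms(1) unfolding cohen_macaulay_local_ring_def by unfold_locales blast
  have sub: "module.subspace (*s) N" and fin: "quotient_length (*s) UNIV N < \<infinity>"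
    and mu: "min_gens (*s) N = enat (CARD('n) + 1)"
    using assms(3) unfolding parameter_module_def by blast+
  obtain a b where ab: "a \<in> m" "b \<in> m" "regular_pair a b"
    using assms(1,2) unfolding cohen_macaulay_local_ring_def
    by (metis depth_two_regular_pair)
  obtain G where G: "finite G" "module.span (*s) G = N" "card G = CARD('n) + 1"
    using mu by (rule min_gens_attained)
  have "card (UNIV :: 'n option set) = card G" by (simp add: G(3))
  then obtain g where g: "bij_betw g (UNIV :: 'n option set) G"
    using finite_same_card_bij[OF finite G(1)] by blast
  have N_eq: "N = {\<Sum>i\<in>UNIV. c i *s g i | c. True}"
  proof -
    have "(\<Sum>v\<in>G. u v *s v) = (\<Sum>i\<in>UNIV. u (g i) *s g i)" for u
      by (rule sum.reindex_bij_betw[OF g, symmetric])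
    then have "N = range (\<lambda>u. \<Sum>i\<in>UNIV. u (g i) *s g i)"
      unfolding G(2)[symmetric] module.span_finite[OF module_vec G(1)] by simp
    moreover have "\<exists>u. (\<Sum>i\<in>UNIV. c i *s g i) = (\<Sum>i\<in>UNIV. u (g i) *s g i)" for c
      using g by (intro exI[of _ "\<lambda>v. c (inv g v)"]) (simp add: bij_betw_def)
    ultimately show ?thesis by auto
  qed
  have gN: "g i \<in> N" for i
    using g G(2) module.span_base[OF module_vec, of _ G] unfolding bij_betw_def by blast
  interpret P: presented_module m g a b
  proof
    show "g i $ p \<in> m" for i p
      using ideal_times_free_entries[OF m_ideal] gN assms(4) by blast
    show "\<exists>k. \<forall>v. \<exists>c. x ^ k *s v = (\<Sum>i\<in>UNIV. c i *s g i)" if "x \<in> m" for x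
      using power_scale_mem_finite_colength[OF fin sub that] unfolding N_eq by simp
  qed (use ab in auto)
  have PN: "P.N = N" unfolding P.N_def N_eq ..
  have M: "M = module_colon P.N m" unfolding PN by (rule assms(5))
  let ?closed = "integrally_closed_module N"
  let ?sq = "submodule_prod M M = submodule_prod N M"
  let ?reg = "regular_local_ring m \<and> CARD('n) = 1 \<and> integrally_closed_ideal {x $ i | x i. x \<in> N}"
  have "?sq" if "P.socle_tight"
    using P.socle_square_if_socle_tight[OF that] unfolding M PN .
  moreover have "?reg" if "\<not> P.socle_tight"
    using P.regular_and_closed_if_not_socle_tight[OF that] noeth_local assms(2)
    unfolding PN regular_local_ring_def by simp
  moreover have "?closed" if "?reg"
    using P.integrally_closed_if_rank_one that unfolding PN by blast
  moreover have "\<not> ?closed" if "?sq"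
    using P.not_integrally_closed_if_square_eq fin that unfolding M PN by blast
  ultimately show ?thesis by blast
qed

end
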